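(* Let $n\in\mathbb{N}$, let $K$ be a field of characteristic $0$, let $W$ be the $n$-th Weyl algebra over $K$, and let $L$ be a left ideal of $W$. Let $\chi(L)$ denote the number of distinct ideals $\mathrm{G}^\omega L$ of $K[X,Y]$ as $\omega$ varies in $\Omega$. Then $$\chi(L)\le\inf_U\ \prod_{u\in U}\ \sum_{0\le k\le\#\mathrm{supp}(u)}\binom{\#\mathrm{supp}(u)}{k},$$ the infimum being taken over all universal Gröbner bases $U$ of $L$. Hence the same quantity is also an upper bound for the number of distinct $\omega$-characteristic varieties $\mathcal{V}^\omega(W/L)$, $\omega\in\Omega$.
   Context: $\mathbb{N}=\{1,2,\dots\}$, $\mathbb{N}_0=\mathbb{N}\cup\{0\}$. $K[X,Y]=K[X_1,\dots,X_n,Y_1,\dots,Y_n]$. The $n$-th Weyl algebra $W$ is the $K$-subalgebra of $\mathrm{End}_K(K[X_1,\dots,X_n])$ generated by $\xi_i$ (multiplication by $X_i$) and $\partial_i=\partial/\partial X_i$, $1\le i\le n$. It has $K$-basis $\{\xi^\lambda\partial^\mu\mid\lambda,\mu\in\mathbb{N}_0^n\}$; for $w=\sum c_{\lambda\mu}\xi^\lambda\partial^\mu$ put $\mathrm{supp}(w)=\{(\lambda,\mu)\mid c_{\lambda\mu}\neq0\}$. Let $(\lambda|\mu)\in\mathbb{N}_0^{2n}$ denote concatenation and $\cdot$ the standard scalar product. For $\omega\in\mathbb{N}_0^{2n}$, $\deg^\omega(w)=\sup\{\omega\cdot(\lambda|\mu)\mid(\lambda,\mu)\in\mathrm{supp}(w)\}$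 (so $\deg^\omega(0)=-\infty$). $\Omega=\{\omega\in\mathbb{N}_0^{2n}\mid\omega_i+\omega_{n+i}>0\text{ for }1\le i\le n\}$. For $\omega\in\Omega$, $W$ is filtered by $\mathrm{F}^\omega_iW=\{w\in W\mid\deg^\omega(w)\le i\}$, $i\in\mathbb{Z}$; the associated graded ring $\mathrm{G}^\omega W=\bigoplus_i\mathrm{F}^\omega_iW/\mathrm{F}^\omega_{i-1}W$ is commutative and is identified with $K[X,Y]$ by letting $X_i,Y_i$ correspond to the classes of $\xi_i,\partial_i$ in degrees $\omega_i,\omega_{n+i}$. A left ideal $L$ carries the induced filtration $(\mathrm{F}^\omega_iW\cap L)_i$, and its associated graded module $\mathrm{G}^\omega L$ is regarded as an ideal of $\mathrm{G}^\omega W=K[X,Y]$ (generated by the symbols of the elements of $L$). A filtration $(\mathrm{F}_iM)_{i\in\mathbb{Z}}$ of a left $W$-module $M$ over $W$ with the $\omega$-filtration is good if there are finitely many $m_j\in M$, $p_j\in\mathbb{Z}$ with $\mathrm{F}_iM=\sum_j\mathrm{F}^\omega_{i-p_j}W\,m_j$ for all $i$. For a finitely generated left $W$-module $M$, the $\omega$-characteristic variety is $\mathcal{V}^\omega(M)=\mathrm{Var}(0:\mathrm{G}^\omega M)\subseteq\mathrm{Spec}(K[X,Y])$, the closed set of primes containing the annihilator of the associated graded module $\mathrm{G}^\omega M$ with respect to any good filtration; it is independent of the good filtration chosen. A normal ordering is a total ordering $\preceq$ on $\mathbb{N}_0^n\times\mathbb{N}_0^n$ with $(0,0)\preceq(\lambda,\mu)$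 for all $(\lambda,\mu)$, and with $(\lambda,\mu)\preceq(\rho,\sigma)\Rightarrow(\lambda+\alpha,\mu+\beta)\preceq(\rho+\alpha,\sigma+\beta)$. For $w\in W\setminus\{0\}$ let $\mathrm{LM}_\preceq(w)=X^\lambda Y^\mu\in K[X,Y]$, where $(\lambda,\mu)$ is the $\preceq$-greatest element of $\mathrm{supp}(w)$. A finite subset $B\subseteq L$ is a $\preceq$-Gröbner basis of $L$ if $L=\sum_{b\in B}Wb$ and the ideal of $K[X,Y]$ generated by all $\mathrm{LM}_\preceq(x)$, $x\in L\setminus\{0\}$, is generated by the $\mathrm{LM}_\preceq(b)$, $b\in B\setminus\{0\}$. A finite subset $U\subseteq L$ is a universal Gröbner basis of $L$ if it is a $\preceq$-Gröbner basis of $L$ for every normal ordering $\preceq$; every left ideal of $W$ admits one. *)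

theory Defs
  imports
    "HOL-Library.Poly_Mapping"
    "HOL-Library.Product_Plus"
    "HOL-Library.Extended_Real"
    "HOL-Algebra.Module"
    "HOL-Algebra.AbelCoset"
    "HOL-Algebra.Ideal"
    "HOL-Algebra.Algebraic_Closure_Type"
begin

section \<open>Polynomials and the Weyl algebra\<close>

text \<open>
  The number of variables is \<open>n = CARD('n)\<close> for a finite index type \<open>'n\<close>. Polynomial rings are
  monoid algebras with the convolution product of \<^theory>\<open>HOL-Library.Poly_Mapping\<close>:
  \<open>K[X]\<close> has exponents \<open>\<lambda> :: 'n exponent\<close>, and \<open>K[X,Y]\<close> has exponents \<open>(\<lambda>, \<mu>)\<close>, standing for the
  monomial \<open>X\<^sup>\<lambda> Y\<^sup>\<mu>\<close>, i.e. for the concatenation \<open>(\<lambda>|\<mu>)\<close>.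
\<close>

type_synonym 'n exponent = "'n \<Rightarrow>\<^sub>0 nat"
type_synonym ('n, 'k) poly_X = "'n exponent \<Rightarrow>\<^sub>0 'k"
type_synonym ('n, 'k) poly_XY = "('n exponent \<times> 'n exponent) \<Rightarrow>\<^sub>0 'k"

definition const_X :: "'k \<Rightarrow> ('n, 'k::comm_ring_1) poly_X" where
  "const_X c = Poly_Mapping.single 0 c"

definition var_X :: "'n \<Rightarrow> ('n, 'k::comm_ring_1) poly_X" where
  "var_X i = Poly_Mapping.single (Poly_Mapping.single i 1) 1"

text \<open>If \<open>\<kappa>\<^sub>i = 0\<close>, the truncated exponent below is harmless, since the coefficient vanishes.\<close>

definition partial_deriv :: "'n \<Rightarrow> ('n, 'k::comm_ring_1) poly_X \<Rightarrow> ('n, 'k) poly_X" where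
  "partial_deriv i p = (\<Sum>\<kappa>\<in>Poly_Mapping.keys p.
     Poly_Mapping.single (\<kappa> - Poly_Mapping.single i 1)
       (of_nat (Poly_Mapping.lookup \<kappa> i) * Poly_Mapping.lookup p \<kappa>))"

inductive_set weyl_operators ::
    "(('n::finite, 'k::field_char_0) poly_X \<Rightarrow> ('n, 'k) poly_X) set" where
  mult_var: "(\<lambda>p. var_X i * p) \<in> weyl_operators"
| deriv: "partial_deriv i \<in> weyl_operators"
| scalar: "(\<lambda>p. const_X c * p) \<in> weyl_operators"
| add: "f \<in> weyl_operators \<Longrightarrow> g \<in> weyl_operators \<Longrightarrow> (\<lambda>p. f p + g p) \<in> weyl_operators"
| comp: "f \<in> weyl_operators \<Longrightarrow> g \<in> weyl_operators \<Longrightarrow> (\<lambda>p. f (g p)) \<in> weyl_operators"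

lemma partial_deriv_add: "partial_deriv i (p + q) = partial_deriv i p + partial_deriv i q"
  unfolding partial_deriv_def
  by (rule setsum_keys_plus_distrib) (auto simp: single_add[symmetric] algebra_simps)

lemma weyl_operators_add: "f \<in> weyl_operators \<Longrightarrow> f (p + q) = f p + f q"
  by (induction arbitrary: p q rule: weyl_operators.induct)
    (simp_all add: partial_deriv_add algebra_simps)

lemma weyl_operators_id:
  "(\<lambda>p :: ('n::finite, 'k::field_char_0) poly_X. p) \<in> weyl_operators"
proof -
  have "(\<lambda>p. const_X 1 * p) = (\<lambda>p :: ('n, 'k) poly_X. p)"
    by (simp add: fun_eq_iff const_X_def)
  then show ?thesis
    using weyl_operators.scalar[of 1] by metis
qed

lemma weyl_operators_zero:
  "(\<lambda>p. 0 :: ('n::finite, 'k::field_char_0) poly_X) \<in> weyl_operators"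
proof -
  have "(\<lambda>p. const_X 0 * p) = (\<lambda>p. 0 :: ('n, 'k) poly_X)"
    by (simp add: fun_eq_iff const_X_def)
  then show ?thesis
    using weyl_operators.scalar[of 0] by metis
qed

lemma weyl_operators_uminus:
  assumes "f \<in> weyl_operators" shows "(\<lambda>p. - f p) \<in> weyl_operators"
  using weyl_operators.comp[OF weyl_operators.scalar[of "-1"] assms]
  by (simp add: const_X_def single_uminus)

typedef (overloaded) ('n, 'k) weyl =
  "weyl_operators :: (('n::finite, 'k::field_char_0) poly_X \<Rightarrow> ('n, 'k) poly_X) set"
  morphisms weyl_apply Abs_weyl
  using weyl_operators_id by blast

setup_lifting type_definition_weyl

lemma weyl_apply_add: "weyl_apply w (p + q) = weyl_apply w p + weyl_apply w q"
  using weyl_apply weyl_operators_add by blast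

instantiation weyl :: (finite, field_char_0) ring_1
begin

lift_definition zero_weyl :: "('a, 'b) weyl" is "\<lambda>p. 0"
  by (rule weyl_operators_zero)
lift_definition one_weyl :: "('a, 'b) weyl" is "\<lambda>p. p"
  by (rule weyl_operators_id)
lift_definition plus_weyl :: "('a, 'b) weyl \<Rightarrow> ('a, 'b) weyl \<Rightarrow> ('a, 'b) weyl"
  is "\<lambda>f g p. f p + g p" by (rule weyl_operators.add)
lift_definition uminus_weyl :: "('a, 'b) weyl \<Rightarrow> ('a, 'b) weyl"
  is "\<lambda>f p. - f p" by (rule weyl_operators_uminus)
lift_definition minus_weyl :: "('a, 'b) weyl \<Rightarrow> ('a, 'b) weyl \<Rightarrow> ('a, 'b) weyl"
  is "\<lambda>f g p. f p - g p"
  using weyl_operators.add[OF _ weyl_operators_uminus] by simp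
lift_definition times_weyl :: "('a, 'b) weyl \<Rightarrow> ('a, 'b) weyl \<Rightarrow> ('a, 'b) weyl"
  is "\<lambda>f g p. f (g p)" by (rule weyl_operators.comp)

instance
proof
  show "(0 :: ('a, 'b) weyl) \<noteq> 1"
  proof transfer
    have "(0 :: ('a, 'b) poly_X) \<noteq> 1" by simp
    then show "(\<lambda>p. 0 :: ('a, 'b) poly_X) \<noteq> (\<lambda>p. p)" by metis
  qed
qed (transfer; simp add: weyl_operators_add algebra_simps)+

end

lift_definition weyl_xi :: "'n \<Rightarrow> ('n::finite, 'k::field_char_0) weyl" is "\<lambda>i p. var_X i * p"
  by (rule weyl_operators.mult_var)

lift_definition weyl_del :: "'n \<Rightarrow> ('n::finite, 'k::field_char_0) weyl" is partial_deriv
  by (rule weyl_operators.deriv)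

lift_definition weyl_scalar :: "'k \<Rightarrow> ('n::finite, 'k::field_char_0) weyl" is "\<lambda>c p. const_X c * p"
  by (rule weyl_operators.scalar)

text \<open>
  \<open>weyl_prod g \<alpha>\<close> is the product of all \<open>g i ^ \<alpha>\<^sub>i\<close>. It is used for the \<open>\<xi>\<^sub>i\<close> and for the \<open>\<partial>\<^sub>i\<close>, which commute
  among themselves, so that the order of the factors does not matter; \<open>weyl_monom (\<lambda>, \<mu>)\<close> is
  \<open>\<xi>\<^sup>\<lambda> \<partial>\<^sup>\<mu>\<close>.
\<close>

definition weyl_prod :: "('n \<Rightarrow> ('n, 'k) weyl) \<Rightarrow> 'n exponent \<Rightarrow> ('n::finite, 'k::field_char_0) weyl" where
  "weyl_prod g \<alpha> = Finite_Set.fold (\<lambda>i w. g i ^ Poly_Mapping.lookup \<alpha> i * w) 1 UNIV"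

definition weyl_monom :: "'n exponent \<times> 'n exponent \<Rightarrow> ('n::finite, 'k::field_char_0) weyl" where
  "weyl_monom m = weyl_prod weyl_xi (fst m) * weyl_prod weyl_del (snd m)"

definition weyl_of_coeffs :: "('n, 'k) poly_XY \<Rightarrow> ('n::finite, 'k::field_char_0) weyl" where
  "weyl_of_coeffs c =
     (\<Sum>m\<in>Poly_Mapping.keys c. weyl_scalar (Poly_Mapping.lookup c m) * weyl_monom m)"


section \<open>The monomials form a basis of the Weyl algebra\<close>

lemma partial_deriv_zero [simp]: "partial_deriv i 0 = 0"
  by (simp add: partial_deriv_def)

lemma partial_deriv_single:
  "partial_deriv i (Poly_Mapping.single \<kappa> c) =
     Poly_Mapping.single (\<kappa> - Poly_Mapping.single i 1) (of_nat (Poly_Mapping.lookup \<kappa> i) * c)"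
  by (simp add: partial_deriv_def)

lemma partial_deriv_const: "partial_deriv i (const_X c) = 0"
  by (simp add: const_X_def partial_deriv_single)

lemma single_induct_poly:
  fixes P :: "('a \<Rightarrow>\<^sub>0 'b::comm_monoid_add) \<Rightarrow> bool"
  assumes "\<And>k c. P (Poly_Mapping.single k c)" "\<And>p q. P p \<Longrightarrow> P q \<Longrightarrow> P (p + q)" "P 0"
  shows "P p"
proof (induction p rule: update_induct)
  case const then show ?case using assms(3) by simp
next
  case (update p a b)
  have "Poly_Mapping.update a b p = Poly_Mapping.single a b + p"
    using update(1) by (intro poly_mapping_eqI)
      (auto simp: lookup_update lookup_add lookup_single in_keys_iff when_def)
  then show ?case using assms update by metis
qed

lemma expo_shift:
  fixes \<alpha> \<beta> :: "'n exponent"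
  shows "of_nat (Poly_Mapping.lookup \<alpha> i) * (c::'k::comm_ring_1) = 0 \<or>
    \<alpha> - Poly_Mapping.single i 1 + \<beta> = \<alpha> + \<beta> - Poly_Mapping.single i 1"
proof (cases "Poly_Mapping.lookup \<alpha> i = 0")
  case False
  have "Poly_Mapping.lookup (\<alpha> - Poly_Mapping.single i 1 + \<beta>) j
      = Poly_Mapping.lookup (\<alpha> + \<beta> - Poly_Mapping.single i 1) j" for j
    using False by (auto simp: lookup_add lookup_minus lookup_single when_def)
  then show ?thesis by (simp add: poly_mapping_eqI)
qed simp

lemma partial_deriv_mult_single:
  fixes c d :: "'k::comm_ring_1" and \<alpha> \<beta> :: "'n exponent"
  shows "partial_deriv i (Poly_Mapping.single \<alpha> c * Poly_Mapping.single \<beta> d) =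
    partial_deriv i (Poly_Mapping.single \<alpha> c) * Poly_Mapping.single \<beta> d +
    Poly_Mapping.single \<alpha> c * partial_deriv i (Poly_Mapping.single \<beta> d)"
proof -
  let ?e = "Poly_Mapping.single i (1::nat)"
  have 1: "Poly_Mapping.single (\<alpha> - ?e + \<beta>) (of_nat (Poly_Mapping.lookup \<alpha> i) * c * d)
     = Poly_Mapping.single (\<alpha> + \<beta> - ?e) (of_nat (Poly_Mapping.lookup \<alpha> i) * c * d)"
    using expo_shift[of \<alpha> i c \<beta>] by auto
  have 2: "Poly_Mapping.single (\<alpha> + (\<beta> - ?e)) (c * (of_nat (Poly_Mapping.lookup \<beta> i) * d))
     = Poly_Mapping.single (\<alpha> + \<beta> - ?e) (c * (of_nat (Poly_Mapping.lookup \<beta> i) * d))"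
    using expo_shift[of \<beta> i d \<alpha>] by (auto simp: add.commute)
  show ?thesis
    unfolding partial_deriv_single mult_single 1 2 single_add[symmetric] 
    by (simp add: lookup_add algebra_simps)
qed

lemma partial_deriv_mult:
  fixes p q :: "('n, 'k::comm_ring_1) poly_X"
  shows "partial_deriv i (p * q) = partial_deriv i p * q + p * partial_deriv i q"
proof (induction p rule: single_induct_poly)
  case (1 \<alpha> c)
  show ?case
    by (induction q rule: single_induct_poly)
      (simp_all add: partial_deriv_mult_single partial_deriv_add algebra_simps)
qed (simp_all add: partial_deriv_add algebra_simps)

lemma weyl_eqI: "(\<And>p. weyl_apply v p = weyl_apply w p) \<Longrightarrow> v = w"
  by transfer (simp add: fun_eq_iff)

lemma weyl_apply_simps [simp]:
  "weyl_apply 0 p = 0" "weyl_apply 1 p = p" "weyl_apply (v + w) p = weyl_apply v p + weyl_apply w p"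
  "weyl_apply (v - w) p = weyl_apply v p - weyl_apply w p"
  "weyl_apply (v * w) p = weyl_apply v (weyl_apply w p)"
  "weyl_apply (weyl_xi i) p = var_X i * p"
  "weyl_apply (weyl_del i) p = partial_deriv i p"
  "weyl_apply (weyl_scalar c) p = const_X c * p"
  by (transfer; simp)+

lemma weyl_apply_zero_right [simp]: "weyl_apply w 0 = 0"
  using weyl_apply_add[of w 0 0] by simp

lemma weyl_apply_sum: "weyl_apply (sum f A) p = (\<Sum>a\<in>A. weyl_apply (f a) p)"
  by (induction A rule: infinite_finite_induct) simp_all

lemma weyl_scalar_add: "weyl_scalar (c + d) = weyl_scalar c + weyl_scalar d"
  by (rule weyl_eqI) (simp add: const_X_def single_add algebra_simps)
lemma weyl_scalar_zero [simp]: "weyl_scalar 0 = 0"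
  by (rule weyl_eqI) (simp add: const_X_def)
lemma weyl_scalar_one [simp]: "weyl_scalar 1 = 1"
  by (rule weyl_eqI) (simp add: const_X_def)
lemma weyl_scalar_mult: "weyl_scalar (c * d) = weyl_scalar c * weyl_scalar d"
  by (rule weyl_eqI) (simp add: const_X_def mult_single mult.assoc[symmetric])
lemma weyl_scalar_commute:
  fixes w :: "('n::finite, 'k::field_char_0) weyl"
  shows "weyl_scalar c * w = w * weyl_scalar c"
proof -
  have "f (const_X c * p) = const_X c * f p" if "f \<in> weyl_operators" for f :: "('n, 'k) poly_X \<Rightarrow> _" and p
    using that by (induction arbitrary: p rule: weyl_operators.induct)
      (simp_all add: partial_deriv_mult partial_deriv_const algebra_simps)
  from this[OF weyl_apply] show ?thesis by (intro weyl_eqI) simp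
qed

lemma weyl_xi_commute: "weyl_xi i * weyl_xi j = weyl_xi j * weyl_xi i"
  by (rule weyl_eqI) (simp add: algebra_simps)

lemma weyl_del_commute:
  "weyl_del i * weyl_del j = (weyl_del j * weyl_del i :: ('n::finite, 'k::field_char_0) weyl)"
proof (rule weyl_eqI, simp)
  fix p :: "('n, 'k) poly_X"
  show "partial_deriv i (partial_deriv j p) = partial_deriv j (partial_deriv i p)"
  proof (induction p rule: single_induct_poly)
    case (1 k c)
    show ?case
      by (cases "i = j") (simp_all add: partial_deriv_single lookup_minus lookup_single diff_diff_eq 
           ac_simps)
  qed (simp_all add: partial_deriv_add)
qed

lemma weyl_monom_weyl_prod: "weyl_monom m = weyl_prod weyl_xi (fst m) * weyl_prod weyl_del (snd m)"
  by (simp add: weyl_monom_def)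

lemma power_commute_aux:
  fixes x y :: "'r::monoid_mult" assumes "x * y = y * x" shows "x ^ k * y ^ l = y ^ l * x ^ k"
proof -
  have "x * y ^ l = y ^ l * x" for l
    by (induction l) (simp_all add: assms mult.assoc[symmetric], metis assms mult.assoc)
  then show ?thesis
    by (induction k) (simp_all add: mult.assoc, metis mult.assoc)
qed

lemma weyl_prod_add_single:
  assumes "\<And>i j. g i * g j = g j * g i"
  shows "weyl_prod g (Poly_Mapping.single i 1 + a) = g i * weyl_prod g a"
proof -
  have cc: "comp_fun_commute_on UNIV (\<lambda>i w. g i ^ Poly_Mapping.lookup a i * w)" for a
  proof
    show "(\<lambda>w. g y ^ Poly_Mapping.lookup a y * w) \<circ> (\<lambda>w. g x ^ Poly_Mapping.lookup a x * w) =
       (\<lambda>w. g x ^ Poly_Mapping.lookup a x * w) \<circ> (\<lambda>w. g y ^ Poly_Mapping.lookup a y * w)" for x y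
      by (simp add: fun_eq_iff mult.assoc[symmetric] power_commute_aux[OF assms, of y _ x])
  qed
  have *: "weyl_prod g a = g i ^ Poly_Mapping.lookup a i *
      Finite_Set.fold (\<lambda>i w. g i ^ Poly_Mapping.lookup a i * w) 1 (UNIV - {i})" for a
    unfolding weyl_prod_def
    using comp_fun_commute_on.fold_rec[OF cc[of a], of UNIV i 1] by simp
  have "Finite_Set.fold (\<lambda>j w. g j ^ Poly_Mapping.lookup (Poly_Mapping.single i 1 + a) j * w) 1 (UNIV - {i})
    = Finite_Set.fold (\<lambda>j w. g j ^ Poly_Mapping.lookup a j * w) 1 (UNIV - {i})"
    by (rule Finite_Set.fold_cong[where S=UNIV, OF cc cc]) (auto simp: lookup_add lookup_single when_def)
  then show ?thesis unfolding *[of "_ + _"] *[of a]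
    by (simp add: lookup_add mult.assoc)
qed

lemma weyl_prod_zero [simp]: "weyl_prod g 0 = 1"
proof -
  have "Finite_Set.fold (\<lambda>(i::'a) (w::('a,'b) weyl). w) 1 A = 1" if "finite A" for A
    using that by (induction) (simp_all add: comp_fun_commute_on.fold_insert[where S=UNIV] comp_fun_commute_on_def fun_eq_iff)
  then show ?thesis by (simp add: weyl_prod_def)
qed

lemmas weyl_prod_xi = weyl_prod_add_single[OF weyl_xi_commute]
lemmas weyl_prod_del = weyl_prod_add_single[OF weyl_del_commute]

lemma expo_induct:
  fixes P :: "'n::finite exponent \<Rightarrow> bool"
  assumes "P 0" "\<And>i a. P a \<Longrightarrow> P (Poly_Mapping.single i 1 + a)"
  shows "P a"
proof (induction "\<Sum>i\<in>UNIV. Poly_Mapping.lookup a i" arbitrary: a)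
  case 0
  then have "a = 0" by (intro poly_mapping_eqI) simp
  then show ?case using assms by simp
next
  case (Suc n)
  then obtain i where i: "Poly_Mapping.lookup a i \<noteq> 0"
    by (metis (mono_tags, lifting) nat.distinct(1) sum.neutral)
  define b where "b = a - Poly_Mapping.single i 1"
  have a: "a = Poly_Mapping.single i 1 + b"
    unfolding b_def using i
    by (intro poly_mapping_eqI) (auto simp: lookup_add lookup_minus lookup_single when_def)
  have "(\<Sum>i\<in>UNIV. Poly_Mapping.lookup a i) = 1 + (\<Sum>i\<in>UNIV. Poly_Mapping.lookup b i)"
    unfolding a lookup_add sum.distrib by (simp add: lookup_single when_def)
  with Suc show ?case unfolding a by (intro assms(2)) auto
qed

lemma weyl_prod_xi_apply: "weyl_apply (weyl_prod weyl_xi a) p = Poly_Mapping.single a 1 * p"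
proof (induction a rule: expo_induct)
  case 1
  then show ?case by simp
next
  case (2 i a)
  then show ?case by (simp add: weyl_prod_xi[simplified] var_X_def mult.assoc[symmetric] mult_single)
qed

lemma del_xi: "weyl_del i * weyl_prod weyl_xi a = weyl_prod weyl_xi a * weyl_del i +
   weyl_scalar (of_nat (Poly_Mapping.lookup a i)) * weyl_prod weyl_xi (a - Poly_Mapping.single i 1)"
  by (rule weyl_eqI)
   (simp add: weyl_prod_xi_apply partial_deriv_mult partial_deriv_single const_X_def mult_single mult.assoc[symmetric]
     del: single_of_nat)

lemma weyl_of_coeffs_add: "weyl_of_coeffs (c + d) = weyl_of_coeffs c + weyl_of_coeffs d"
  unfolding weyl_of_coeffs_def
  by (rule setsum_keys_plus_distrib) (auto simp: weyl_scalar_add algebra_simps)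

lemma weyl_of_coeffs_zero [simp]: "weyl_of_coeffs 0 = 0"
  by (simp add: weyl_of_coeffs_def)

lemma weyl_of_coeffs_single: "weyl_of_coeffs (Poly_Mapping.single m c) = weyl_scalar c * weyl_monom m"
  by (simp add: weyl_of_coeffs_def)

lemma range_add:
  assumes "v \<in> range weyl_of_coeffs" "w \<in> range weyl_of_coeffs"
  shows "v + w \<in> range weyl_of_coeffs"
  using assms
proof (elim rangeE)
  fix c d assume "v = weyl_of_coeffs c" "w = weyl_of_coeffs d"
  then have "v + w = weyl_of_coeffs (c + d)" by (simp add: weyl_of_coeffs_add)
  then show ?thesis by (simp only: rangeI)
qed

lemma range_monom: "weyl_scalar c * weyl_monom m \<in> range weyl_of_coeffs"
  unfolding weyl_of_coeffs_single[symmetric] by (rule rangeI)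

lemma range_left:
  fixes v w :: "('n::finite, 'k::field_char_0) weyl"
  assumes "\<And>c m. v * (weyl_scalar c * weyl_monom m) \<in> range weyl_of_coeffs" "w \<in> range weyl_of_coeffs"
  shows "v * w \<in> range weyl_of_coeffs"
proof -
  have "v * weyl_of_coeffs c \<in> range weyl_of_coeffs" for c
  proof (induction c rule: single_induct_poly)
    case (1 m c)
    show ?case unfolding weyl_of_coeffs_single by (rule assms(1))
  next
    case (2 p q)
    then show ?case unfolding weyl_of_coeffs_add distrib_left by (rule range_add)
  next
    case 3
    show ?case by (rule image_eqI[of _ _ 0]) simp_all
  qed
  then show ?thesis using assms(2) by auto
qed

lemma range_xi: "weyl_xi i * (weyl_scalar c * weyl_monom (a, b)) \<in> range weyl_of_coeffs"
proof -
  have "weyl_xi i * (weyl_scalar c * weyl_monom (a, b)) = weyl_scalar c * weyl_monom (Poly_Mapping.single i 1 + a, b)"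
    by (simp add: weyl_monom_weyl_prod weyl_prod_xi[simplified] mult.assoc[symmetric] weyl_scalar_commute[of c "weyl_xi i"])
  then show ?thesis by (simp only: range_monom)
qed

lemma range_del: "weyl_del i * (weyl_scalar c * weyl_monom (a, b)) \<in> range weyl_of_coeffs"
proof -
  have "weyl_del i * (weyl_scalar c * weyl_monom (a, b)) =
      weyl_scalar c * (weyl_del i * weyl_prod weyl_xi a) * weyl_prod weyl_del b"
    by (simp add: weyl_monom_weyl_prod mult.assoc[symmetric] weyl_scalar_commute[of c "weyl_del i"])
  also have "\<dots> = weyl_scalar c * weyl_monom (a, Poly_Mapping.single i 1 + b) +
    weyl_scalar (c * of_nat (Poly_Mapping.lookup a i)) * weyl_monom (a - Poly_Mapping.single i 1, b)"
    unfolding del_xi weyl_monom_weyl_prod fst_conv snd_conv weyl_prod_del weyl_scalar_mult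
    by (simp only: distrib_left distrib_right mult.assoc)
  finally show ?thesis by (simp only: range_monom range_add)
qed

lemma weyl_mult_range:
  fixes s v :: "('n::finite, 'k::field_char_0) weyl"
  assumes "s \<in> range weyl_of_coeffs"
  shows "v * s \<in> range weyl_of_coeffs"
proof -
  have *: "f \<in> weyl_operators \<Longrightarrow> s \<in> range weyl_of_coeffs \<Longrightarrow> Abs_weyl f * s \<in> range weyl_of_coeffs"
    for f and s :: "('n, 'k) weyl"
  proof (induction arbitrary: s rule: weyl_operators.induct)
    case (mult_var i)
    have "Abs_weyl (\<lambda>p. var_X i * p) = weyl_xi i" by (simp add: weyl_xi_def)
    show ?case unfolding \<open>Abs_weyl _ = _\<close>
      by (rule range_left[OF _ mult_var]) (use range_xi in \<open>simp only: split_paired_all\<close>)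
  next
    case (deriv i)
    have "Abs_weyl (partial_deriv i) = weyl_del i" by (simp add: weyl_del_def)
    show ?case unfolding \<open>Abs_weyl _ = _\<close>
      by (rule range_left[OF _ deriv]) (use range_del in \<open>simp only: split_paired_all\<close>)
  next
    case (scalar c)
    have "Abs_weyl (\<lambda>p. const_X c * p) = weyl_scalar c" by (simp add: weyl_scalar_def)
    have "weyl_scalar c * (weyl_scalar d * weyl_monom m) \<in> range weyl_of_coeffs" for d m
      using range_monom[of "c * d" m] by (simp only: weyl_scalar_mult mult.assoc)
    then show ?case unfolding \<open>Abs_weyl _ = _\<close>
      by (rule range_left[OF _ scalar])
  next
    case (add f g)
    have "Abs_weyl (\<lambda>p. f p + g p) = Abs_weyl f + Abs_weyl g"
      using add by (simp add: plus_weyl_def Abs_weyl_inverse)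
    then show ?case using add by (simp only: distrib_right range_add)
  next
    case (comp f g)
    have "Abs_weyl (\<lambda>p. f (g p)) = Abs_weyl f * Abs_weyl g"
      using comp by (simp add: times_weyl_def Abs_weyl_inverse)
    then show ?case using comp by (simp only: mult.assoc)
  qed
  show ?thesis
    using *[OF weyl_apply assms, of v] by (simp only: weyl_apply_inverse)
qed

lemma weyl_of_coeffs_surj: "(w :: ('n::finite, 'k::field_char_0) weyl) \<in> range weyl_of_coeffs"
proof -
  have "weyl_of_coeffs (Poly_Mapping.single (0, 0) 1) = (1 :: ('n, 'k) weyl)"
    by (simp add: weyl_of_coeffs_single weyl_monom_weyl_prod)
  then have "1 \<in> range (weyl_of_coeffs :: _ \<Rightarrow> ('n, 'k) weyl)" by (rule range_eqI[OF sym])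
  from weyl_mult_range[OF this, of w] show ?thesis by (simp only: mult_1_right)
qed

abbreviation expo_size :: "'n::finite exponent \<Rightarrow> nat" where
  "expo_size a \<equiv> \<Sum>i\<in>UNIV. Poly_Mapping.lookup a i"

lemma weyl_apply_scale: "weyl_apply w (const_X c * p) = const_X c * weyl_apply w p"
  using arg_cong[OF weyl_scalar_commute[of c w], of "\<lambda>v. weyl_apply v p"] by simp

lemma weyl_prod_del_apply:
  fixes \<kappa> \<mu> :: "'n::finite exponent"
  assumes "expo_size \<kappa> \<le> expo_size \<mu>"
  shows "\<exists>c::'k::field_char_0. weyl_apply (weyl_prod weyl_del \<mu>) (Poly_Mapping.single \<kappa> 1) = const_X c \<and>
     (c \<noteq> 0 \<longleftrightarrow> \<mu> = \<kappa>)"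
  using assms
proof (induction \<mu> arbitrary: \<kappa> rule: expo_induct)
  case 1
  then have "\<kappa> = 0" by (intro poly_mapping_eqI) simp
  then show ?case by (auto intro!: exI[of _ 1] simp: const_X_def)
next
  case (2 i \<mu>)
  have comm: "weyl_prod weyl_del \<mu> * weyl_del i = weyl_del i * (weyl_prod weyl_del \<mu> :: ('n,'k) weyl)" for \<mu> :: "'n exponent"
  proof (induction \<mu> rule: expo_induct)
    case (2 j a)
    have "weyl_del j * weyl_prod weyl_del a * weyl_del i = weyl_del j * weyl_del i * (weyl_prod weyl_del a :: ('n,'k) weyl)"
      using 2 by (simp only: mult.assoc)
    also have "\<dots> = weyl_del i * (weyl_del j * weyl_prod weyl_del a)"
      unfolding weyl_del_commute[of j i] by (simp only: mult.assoc)
    finally show ?case unfolding weyl_prod_del .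
  qed simp
  have eq: "weyl_apply (weyl_prod weyl_del (Poly_Mapping.single i 1 + \<mu>)) (Poly_Mapping.single \<kappa> (1::'k)) =
    const_X (of_nat (Poly_Mapping.lookup \<kappa> i)) *
    weyl_apply (weyl_prod weyl_del \<mu>) (Poly_Mapping.single (\<kappa> - Poly_Mapping.single i 1) 1)"
  proof -
    have "Poly_Mapping.single (\<kappa> - Poly_Mapping.single i 1) (of_nat (Poly_Mapping.lookup \<kappa> i)) =
      const_X (of_nat (Poly_Mapping.lookup \<kappa> i)) * Poly_Mapping.single (\<kappa> - Poly_Mapping.single i 1) (1::'k)"
      by (simp add: const_X_def mult_single del: single_of_nat)
    then show ?thesis
      unfolding weyl_prod_del comm[symmetric] weyl_apply_simps partial_deriv_single mult_1_right
      by (simp only: weyl_apply_scale)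
  qed
  show ?case
  proof (cases "Poly_Mapping.lookup \<kappa> i = 0")
    case True
    then have "Poly_Mapping.single i 1 + \<mu> \<noteq> \<kappa>" by (auto simp: lookup_add)
    with True show ?thesis unfolding eq by (auto intro!: exI[of _ 0] simp: const_X_def)
  next
    case False
    define \<nu> where "\<nu> = \<kappa> - Poly_Mapping.single i 1"
    have \<kappa>: "\<kappa> = Poly_Mapping.single i 1 + \<nu>"
      unfolding \<nu>_def using False
      by (intro poly_mapping_eqI) (auto simp: lookup_add lookup_minus lookup_single when_def)
    have s: "expo_size (Poly_Mapping.single i 1 + b) = 1 + expo_size b" for b :: "'n exponent"
      unfolding lookup_add sum.distrib by (simp add: lookup_single when_def)
    have "expo_size \<nu> \<le> expo_size \<mu>" using 2(2) unfolding \<kappa> s by simp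
    from 2(1)[OF this] obtain c :: 'k where c: "weyl_apply (weyl_prod weyl_del \<mu>) (Poly_Mapping.single \<nu> 1) = const_X c"
      "(c \<noteq> 0) = (\<mu> = \<nu>)" by blast
    show ?thesis
      unfolding eq \<nu>_def[symmetric] c(1)
      by (rule exI[of _ "of_nat (Poly_Mapping.lookup \<kappa> i) * c"])
        (use False c(2) in \<open>auto simp: const_X_def mult_single \<kappa> simp del: single_of_nat\<close>)
  qed
qed

lemma weyl_of_coeffs_eq_0:
  fixes c :: "('a::finite, 'b::field_char_0) poly_XY"
  assumes "weyl_of_coeffs c = 0" shows "c = 0"
proof (rule ccontr)
  assume "c \<noteq> 0"
  then have ne: "Poly_Mapping.keys c \<noteq> {}"
    by (metis empty_iff in_keys_iff lookup_zero poly_mapping_eqI)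
  then obtain m where m: "m \<in> Poly_Mapping.keys c"
    "\<And>m'. m' \<in> Poly_Mapping.keys c \<Longrightarrow> expo_size (snd m) \<le> expo_size (snd m')"
    using arg_min_if_finite[of "Poly_Mapping.keys c" "\<lambda>m. expo_size (snd m)"]
    using ne finite_keys not_less by metis
  obtain \<alpha> \<mu> where m_eq: "m = (\<alpha>, \<mu>)" by (cases m)
  define d where "d m' = (SOME x::'b. weyl_apply (weyl_prod weyl_del (snd m')) (Poly_Mapping.single \<mu> 1) = const_X x
     \<and> (x \<noteq> 0 \<longleftrightarrow> snd m' = \<mu>))" for m' :: "'a exponent \<times> 'a exponent"
  have d: "weyl_apply (weyl_prod weyl_del (snd m')) (Poly_Mapping.single \<mu> 1) = const_X (d m') \<and> (d m' \<noteq> 0 \<longleftrightarrow> snd m' = \<mu>)"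
    if "m' \<in> Poly_Mapping.keys c" for m'
    unfolding d_def
    by (rule someI_ex) (rule weyl_prod_del_apply, use m(2)[OF that] m_eq in auto)
  have "0 = weyl_apply (weyl_of_coeffs c) (Poly_Mapping.single \<mu> 1)" using assms by simp
  also have "\<dots> = (\<Sum>m'\<in>Poly_Mapping.keys c. Poly_Mapping.single (fst m') (Poly_Mapping.lookup c m' * d m'))"
    unfolding weyl_of_coeffs_def weyl_apply_sum
    by (rule sum.cong) (simp_all add: weyl_monom_weyl_prod weyl_prod_xi_apply d const_X_def mult_single)
  finally have "0 = Poly_Mapping.lookup (\<Sum>m'\<in>Poly_Mapping.keys c. Poly_Mapping.single (fst m') (Poly_Mapping.lookup c m' * d m')) \<alpha>"
    by simp
  also have "\<dots> = (\<Sum>m'\<in>Poly_Mapping.keys c. if m' = m then Poly_Mapping.lookup c m * d m else 0)"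
    unfolding lookup_sum
    by (rule sum.cong) (use d m_eq in \<open>auto simp: lookup_single when_def prod_eq_iff\<close>)
  also have "\<dots> = Poly_Mapping.lookup c m * d m" using m(1) by simp
  finally show False using d[OF m(1)] m(1) m_eq by (simp add: in_keys_iff)
qed

lemma weyl_basis: "\<exists>!c. weyl_of_coeffs c = (w :: ('n::finite, 'k::field_char_0) weyl)"
proof (rule ex_ex1I)
  show "\<exists>c. weyl_of_coeffs c = w" using weyl_of_coeffs_surj[of w] by auto
next
  fix c d :: "('n, 'k) poly_XY" assume "weyl_of_coeffs c = w" "weyl_of_coeffs d = w"
  then have "weyl_of_coeffs (c - d) = 0" using weyl_of_coeffs_add[of "c - d" d] by simp
  then show "c = d" using weyl_of_coeffs_eq_0[of "c - d"] by simp
qed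


section \<open>Supports, weights and the weight filtrations\<close>

definition weyl_coeffs :: "('n::finite, 'k::field_char_0) weyl \<Rightarrow> ('n, 'k) poly_XY" where
  "weyl_coeffs w = (THE c. weyl_of_coeffs c = w)"

lemma weyl_coeffs_eq_iff: "weyl_coeffs w = c \<longleftrightarrow> weyl_of_coeffs c = w"
  unfolding weyl_coeffs_def using theI'[OF weyl_basis[of w]] weyl_basis[of w] by auto

definition weyl_supp :: "('n::finite, 'k::field_char_0) weyl \<Rightarrow> ('n exponent \<times> 'n exponent) set" where
  "weyl_supp w = Poly_Mapping.keys (weyl_coeffs w)"

text \<open>A weight \<open>\<omega> :: 'n + 'n \<Rightarrow> nat\<close> has entries \<open>\<omega>\<^sub>i = \<omega> (Inl i)\<close> and \<open>\<omega>\<^bsub>n+i\<^esub> = \<omega> (Inr i)\<close>.\<close>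

definition Weights :: "('n + 'n \<Rightarrow> nat) set" where
  "Weights = {\<omega>. \<forall>i. \<omega> (Inl i) + \<omega> (Inr i) > 0}"

definition dot :: "('n::finite + 'n \<Rightarrow> nat) \<Rightarrow> 'n exponent \<times> 'n exponent \<Rightarrow> nat" where
  "dot \<omega> m = (\<Sum>i\<in>UNIV. \<omega> (Inl i) * Poly_Mapping.lookup (fst m) i)
           + (\<Sum>i\<in>UNIV. \<omega> (Inr i) * Poly_Mapping.lookup (snd m) i)"

definition weyl_degree :: "('n::finite + 'n \<Rightarrow> nat) \<Rightarrow> ('n, 'k::field_char_0) weyl \<Rightarrow> ereal" where
  "weyl_degree \<omega> w = (SUP m\<in>weyl_supp w. ereal (real (dot \<omega> m)))"

definition weyl_filt :: "('n::finite + 'n \<Rightarrow> nat) \<Rightarrow> int \<Rightarrow> ('n, 'k::field_char_0) weyl set" where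
  "weyl_filt \<omega> i = {w. weyl_degree \<omega> w \<le> ereal (of_int i)}"


section \<open>Modules over the Weyl algebra\<close>

text \<open>
  Left modules over the Weyl algebra are given by records of \<^theory>\<open>HOL-Algebra.Module\<close>, of which
  only the fields for the carrier, the addition, the zero and the scalar multiplication matter.
\<close>

type_synonym ('n, 'k, 'm) weyl_mod = "(('n, 'k) weyl, 'm) module"

definition weyl_module :: "('n::finite, 'k::field_char_0, ('n, 'k) weyl) weyl_mod" where
  "weyl_module = \<lparr>carrier = UNIV, monoid.mult = (*), one = 1, ring.zero = 0, add = (+), module.smult = (*)\<rparr>"

definition left_ideal :: "('n::finite, 'k::field_char_0) weyl set \<Rightarrow> bool" where
  "left_ideal L \<longleftrightarrow> 0 \<in> L \<and> (\<forall>x\<in>L. \<forall>y\<in>L. x + y \<in> L) \<and> (\<forall>w. \<forall>x\<in>L. w * x \<in> L)"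

definition quot_module ::
    "('n::finite, 'k::field_char_0, 'm) weyl_mod \<Rightarrow> 'm set \<Rightarrow> ('n, 'k, 'm set) weyl_mod" where
  "quot_module M N = \<lparr>carrier = a_rcosets\<^bsub>M\<^esub> N, monoid.mult = undefined, one = undefined,
     ring.zero = N, add = set_add M,
     module.smult = (\<lambda>w C. \<Union>c\<in>C. N +>\<^bsub>M\<^esub> (w \<odot>\<^bsub>M\<^esub> c))\<rparr>"

definition filtration :: "('n::finite + 'n \<Rightarrow> nat) \<Rightarrow> ('n, 'k::field_char_0, 'm) weyl_mod
    \<Rightarrow> (int \<Rightarrow> 'm set) \<Rightarrow> bool" where
  "filtration \<omega> M F \<longleftrightarrow>
     (\<forall>i. additive_subgroup (F i) M) \<and> (\<forall>i. F i \<subseteq> F (i + 1)) \<and> (\<Union>i. F i) = carrier M \<and>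
     (\<forall>i j. \<forall>w\<in>weyl_filt \<omega> i. \<forall>x\<in>F j. w \<odot>\<^bsub>M\<^esub> x \<in> F (i + j))"

definition good_filtration :: "('n::finite + 'n \<Rightarrow> nat) \<Rightarrow> ('n, 'k::field_char_0, 'm) weyl_mod
    \<Rightarrow> (int \<Rightarrow> 'm set) \<Rightarrow> bool" where
  "good_filtration \<omega> M F \<longleftrightarrow> filtration \<omega> M F \<and>
     (\<exists>(r::nat) (x::nat \<Rightarrow> 'm) (p::nat \<Rightarrow> int). (\<forall>j<r. x j \<in> carrier M) \<and>
       (\<forall>i. F i = {(\<Oplus>\<^bsub>M\<^esub> j\<in>{..<r}. w j \<odot>\<^bsub>M\<^esub> x j) | w. \<forall>j<r. w j \<in> weyl_filt \<omega> (i - p j)}))"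


section \<open>Associated graded objects\<close>

text \<open>
  An element of \<open>\<Oplus>\<^sub>i F\<^sub>i / F\<^bsub>i-1\<^esub>\<close> is a function mapping each degree \<open>i\<close> to a coset of \<open>F\<^bsub>i-1\<^esub>\<close> in \<open>F\<^sub>i\<close>,
  almost all of them being zero.
\<close>

definition gr_carrier :: "('n::finite, 'k::field_char_0, 'm) weyl_mod \<Rightarrow> (int \<Rightarrow> 'm set)
    \<Rightarrow> (int \<Rightarrow> 'm set) set" where
  "gr_carrier M F = {g. (\<forall>i. \<exists>x\<in>F i. g i = F (i - 1) +>\<^bsub>M\<^esub> x) \<and> finite {i. g i \<noteq> F (i - 1)}}"

definition gr_zero :: "(int \<Rightarrow> 'm set) \<Rightarrow> int \<Rightarrow> 'm set" where
  "gr_zero F = (\<lambda>i. F (i - 1))"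

text \<open>
  The action of the associated graded ring of the Weyl algebra, determined by
  \<open>[w]\<^sub>d [x]\<^sub>j = [w x]\<^bsub>d+j\<^esub>\<close> on classes of \<open>w\<close> in degree \<open>d\<close> and \<open>x\<close> in degree \<open>j\<close>. Representatives of
  the homogeneous components are chosen by \<open>SOME\<close>; the result does not depend on the choice. With
  \<open>M\<close> the Weyl algebra itself, this is also the multiplication of the associated graded ring.
\<close>

definition gr_smult :: "('n::finite + 'n \<Rightarrow> nat) \<Rightarrow> ('n, 'k::field_char_0, 'm) weyl_mod
    \<Rightarrow> (int \<Rightarrow> 'm set) \<Rightarrow> (int \<Rightarrow> ('n, 'k) weyl set) \<Rightarrow> (int \<Rightarrow> 'm set) \<Rightarrow> int \<Rightarrow> 'm set" where
  "gr_smult \<omega> M F a g = (\<lambda>i. F (i - 1) +>\<^bsub>M\<^esub>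
     (\<Oplus>\<^bsub>M\<^esub> d\<in>{d. a d \<noteq> weyl_filt \<omega> (d - 1)}. (SOME w. w \<in> a d) \<odot>\<^bsub>M\<^esub> (SOME x. x \<in> g (i - d))))"

text \<open>
  The identification of \<open>K[X,Y]\<close> with the associated graded ring: the \<open>K\<close>-linear map sending
  \<open>X\<^sup>\<lambda> Y\<^sup>\<mu>\<close> to the class of \<open>\<xi>\<^sup>\<lambda> \<partial>\<^sup>\<mu>\<close> in degree \<open>\<omega> \<cdot> (\<lambda>|\<mu>)\<close>. In particular \<open>X\<^sub>i\<close> and \<open>Y\<^sub>i\<close> go to the
  classes of \<open>\<xi>\<^sub>i\<close> and \<open>\<partial>\<^sub>i\<close> in degrees \<open>\<omega>\<^sub>i\<close> and \<open>\<omega>\<^bsub>n+i\<^esub>\<close>.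
\<close>

definition gr_of_poly :: "('n::finite + 'n \<Rightarrow> nat) \<Rightarrow> ('n, 'k::field_char_0) poly_XY
    \<Rightarrow> int \<Rightarrow> ('n, 'k) weyl set" where
  "gr_of_poly \<omega> p = (\<lambda>d. weyl_filt \<omega> (d - 1) +>\<^bsub>weyl_module\<^esub>
     (\<Sum>m\<in>{m \<in> Poly_Mapping.keys p. int (dot \<omega> m) = d}.
        weyl_scalar (Poly_Mapping.lookup p m) * weyl_monom m))"

text \<open>
  \<open>\<Oplus>\<^sub>i (F\<^sub>i \<inter> L) / (F\<^bsub>i-1\<^esub> \<inter> L)\<close>, mapped into the associated graded ring of the Weyl algebra by the
  inclusion of \<open>L\<close> and viewed in \<open>K[X,Y]\<close>.
\<close>

definition gr_ideal :: "('n::finite + 'n \<Rightarrow> nat) \<Rightarrow> ('n, 'k::field_char_0) weyl set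
    \<Rightarrow> ('n, 'k) poly_XY set" where
  "gr_ideal \<omega> L = {p. \<forall>i. \<exists>x \<in> weyl_filt \<omega> i \<inter> L.
     gr_of_poly \<omega> p i = weyl_filt \<omega> (i - 1) +>\<^bsub>weyl_module\<^esub> x}"

definition gr_annihilator :: "('n::finite + 'n \<Rightarrow> nat) \<Rightarrow> ('n, 'k::field_char_0, 'm) weyl_mod
    \<Rightarrow> (int \<Rightarrow> 'm set) \<Rightarrow> ('n, 'k) poly_XY set" where
  "gr_annihilator \<omega> M F =
     {p. \<forall>g\<in>gr_carrier M F. gr_smult \<omega> M F (gr_of_poly \<omega> p) g = gr_zero F}"

abbreviation K_XY :: "('n, 'k::comm_ring_1) poly_XY ring" where
  "K_XY \<equiv> ring_of_type_algebra"

definition Var :: "('n, 'k::comm_ring_1) poly_XY set \<Rightarrow> ('n, 'k) poly_XY set set" where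
  "Var I = {P. primeideal P K_XY \<and> I \<subseteq> P}"

text \<open>
  The common value for all good filtrations (meaningful for finitely generated \<open>M\<close>, which are
  those with a good filtration).
\<close>

definition char_variety :: "('n::finite + 'n \<Rightarrow> nat) \<Rightarrow> ('n, 'k::field_char_0, 'm) weyl_mod
    \<Rightarrow> ('n, 'k) poly_XY set set" where
  "char_variety \<omega> M = (THE V. \<forall>F. good_filtration \<omega> M F \<longrightarrow> V = Var (gr_annihilator \<omega> M F))"


section \<open>Universal Groebner bases\<close>

definition normal_ordering ::
    "(('n exponent \<times> 'n exponent) \<times> ('n exponent \<times> 'n exponent)) set \<Rightarrow> bool" where
  "normal_ordering r \<longleftrightarrow> linear_order r \<and> (\<forall>a. (0, a) \<in> r) \<and>
     (\<forall>a b c. (a, b) \<in> r \<longrightarrow> (a + c, b + c) \<in> r)"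

definition lead_exponent ::
    "(('n exponent \<times> 'n exponent) \<times> ('n exponent \<times> 'n exponent)) set
      \<Rightarrow> ('n::finite, 'k::field_char_0) weyl \<Rightarrow> 'n exponent \<times> 'n exponent" where
  "lead_exponent r w = (THE a. a \<in> weyl_supp w \<and> (\<forall>b\<in>weyl_supp w. (b, a) \<in> r))"

definition lead_monomial ::
    "(('n exponent \<times> 'n exponent) \<times> ('n exponent \<times> 'n exponent)) set
      \<Rightarrow> ('n::finite, 'k::field_char_0) weyl \<Rightarrow> ('n, 'k) poly_XY" where
  "lead_monomial r w = Poly_Mapping.single (lead_exponent r w) 1"

definition groebner_basis ::
    "(('n exponent \<times> 'n exponent) \<times> ('n exponent \<times> 'n exponent)) set
      \<Rightarrow> ('n::finite, 'k::field_char_0) weyl set \<Rightarrow> ('n, 'k) weyl set \<Rightarrow> bool" where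
  "groebner_basis r L B \<longleftrightarrow> finite B \<and> B \<subseteq> L \<and> L = {(\<Sum>b\<in>B. f b * b) | f. True} \<and>
     Idl\<^bsub>K_XY\<^esub> (lead_monomial r ` (L - {0})) = Idl\<^bsub>K_XY\<^esub> (lead_monomial r ` (B - {0}))"

definition universal_groebner_basis ::
    "('n::finite, 'k::field_char_0) weyl set \<Rightarrow> ('n, 'k) weyl set \<Rightarrow> bool" where
  "universal_groebner_basis L U \<longleftrightarrow> finite U \<and> U \<subseteq> L \<and>
     (\<forall>r. normal_ordering r \<longrightarrow> groebner_basis r L U)"

text \<open>
  The infimum is taken in \<open>nat\<close>. Every left ideal has a universal Groebner basis, so that it is a
  minimum and does not involve the convention \<open>Inf {} = 0\<close> of \<open>nat\<close>.
\<close>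

definition universal_groebner_bound :: "('n::finite, 'k::field_char_0) weyl set \<Rightarrow> nat" where
  "universal_groebner_bound L = (INF U\<in>{U. universal_groebner_basis L U}.
     \<Prod>u\<in>U. \<Sum>k=0..card (weyl_supp u). card (weyl_supp u) choose k)"

end

theory Submission
  imports Defs
begin

text \<open>
  Fix a universal Groebner basis \<open>U\<close> of \<open>L\<close>. For a weight \<open>\<omega>\<close> and \<open>u \<in> U\<close> let the leading face of \<open>u\<close> be
  the set of those exponents in the support of \<open>u\<close> on which \<open>\<omega>\<close> is maximal. The ideal \<open>G\<^sup>\<omega> L\<close> depends
  only on the leading faces of the elements of \<open>U\<close>, and there are at most
  \<open>\<Prod>u\<in>U. 2 ^ card (supp u)\<close> families of subsets of the supports. This is the bound, because a row
  of binomial coefficients sums to a power of two.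

  The dependence on the faces alone comes from division with remainder
  (\<open>gr_ideal_mono_lead_face\<close>): for a normal ordering that compares \<open>\<omega>\<close>-degrees first, dividing
  \<open>x \<in> L\<close> by \<open>U\<close> writes \<open>x\<close> as a sum of terms \<open>c \<xi>\<^sup>\<alpha> \<partial>\<^sup>\<beta> u\<close> whose \<open>\<omega>\<close>-degrees do not exceed that of \<open>x\<close>.
  Hence the symbol of \<open>x\<close> is a combination of the \<open>\<omega>\<close>-symbols of elements of \<open>U\<close>. If \<open>\<omega>'\<close> has the same
  faces, these are also \<open>\<omega>'\<close>-symbols and therefore lie in \<open>G\<^bsup>\<omega>'\<^esup> L\<close>; by symmetry the two ideals
  coincide.

  The noncommutativity enters through one fact only (\<open>weyl_coeffs_mult\<close>): the coefficients of a
  product in the Weyl algebra are those of the commutative product of polynomials, up to terms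
  obtained by removing the same nonzero \<open>s\<close> from both halves of an exponent. Such terms are smaller
  in every normal ordering, and of smaller \<open>\<omega>\<close>-degree for every \<open>\<omega> \<in> \<Omega>\<close>.

  The bound is an infimum of natural numbers, so it is meaningful only because a universal Groebner
  basis exists (\<open>ex_universal_groebner_basis\<close>). The proof refines a finite subset \<open>F\<close> of \<open>L\<close>: if some
  ordering has a leading exponent that the leading exponents of \<open>F\<close> do not divide, a normal form
  computation gives an element of \<open>L\<close> with no such multiple in its support at all. Adding it to
  \<open>F\<close> enlarges the ideal of leading exponents for all orderings at once; only finitely many choices
  of its leading exponent occur, and by Dickson's lemma the process terminates.

  Finally \<open>\<V>\<^sup>\<omega>(W/L) = Var (G\<^sup>\<omega> L)\<close> (\<open>char_variety_quot\<close>), so that there are at most as many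
  characteristic varieties as ideals. For the filtration induced on \<open>W/L\<close> the annihilator of the
  associated graded module is exactly \<open>G\<^sup>\<omega> L\<close>, and the variety is the same for all good filtrations
  because two of them differ by a bounded shift, which a high power of a homogeneous annihilating
  element absorbs (\<open>Var_gr_annihilator_subset\<close>).
\<close>

section \<open>Products in the Weyl algebra are commutative up to diagonally smaller terms\<close>

type_synonym 'n biexponent = "'n exponent \<times> 'n exponent"

lemma weyl_coeffs_of_coeffs [simp]: "weyl_coeffs (weyl_of_coeffs c) = c"
  by (simp add: weyl_coeffs_eq_iff)

lemma weyl_of_coeffs_coeffs [simp]: "weyl_of_coeffs (weyl_coeffs w) = w"
  using weyl_coeffs_eq_iff by blast

lemma weyl_coeffs_zero [simp]: "weyl_coeffs 0 = 0"
  by (simp add: weyl_coeffs_eq_iff)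

lemma weyl_coeffs_eq_0_iff [simp]: "weyl_coeffs w = 0 \<longleftrightarrow> w = 0"
  by (metis weyl_coeffs_zero weyl_of_coeffs_coeffs)

lemma weyl_coeffs_add [simp]: "weyl_coeffs (v + w) = weyl_coeffs v + weyl_coeffs w"
  by (simp add: weyl_coeffs_eq_iff weyl_of_coeffs_add)

lemma weyl_coeffs_diff [simp]: "weyl_coeffs (v - w) = weyl_coeffs v - weyl_coeffs w"
  by (metis add_diff_cancel_right' diff_add_cancel weyl_coeffs_add)

lemma weyl_coeffs_sum: "weyl_coeffs (sum f A) = (\<Sum>a\<in>A. weyl_coeffs (f a))"
  by (induction A rule: infinite_finite_induct) simp_all

lemma weyl_coeffs_term [simp]: "weyl_coeffs (weyl_scalar c * weyl_monom m) = Poly_Mapping.single m c"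
  by (simp add: weyl_coeffs_eq_iff weyl_of_coeffs_single)

lemma weyl_coeffs_monom [simp]: "weyl_coeffs (weyl_monom m) = Poly_Mapping.single m 1"
  using weyl_coeffs_term[of 1 m] by simp

lemma weyl_coeffs_one [simp]: "weyl_coeffs 1 = 1"
  using weyl_coeffs_monom[of 0] by (simp add: weyl_monom_def)

lemma weyl_coeffs_scalar:
  "weyl_coeffs (weyl_scalar c * w) = Poly_Mapping.single 0 c * weyl_coeffs w"
proof -
  have "weyl_coeffs (weyl_scalar c * weyl_of_coeffs p) = Poly_Mapping.single 0 c * p" for p
  proof (induction p rule: single_induct_poly)
    case (1 k d)
    show ?case
      unfolding weyl_of_coeffs_single mult.assoc[symmetric] weyl_scalar_mult[symmetric]
      by (simp add: weyl_coeffs_term mult_single)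
  qed (simp_all add: weyl_of_coeffs_add distrib_left)
  from this[of "weyl_coeffs w"] show ?thesis by simp
qed

lemma weyl_supp_zero [simp]: "weyl_supp 0 = {}"
  by (simp add: weyl_supp_def)

lemma weyl_supp_eq_empty_iff [simp]: "weyl_supp w = {} \<longleftrightarrow> w = 0"
  by (simp add: weyl_supp_def)

lemma finite_weyl_supp [simp]: "finite (weyl_supp w)"
  by (simp add: weyl_supp_def)

lemma weyl_supp_add: "weyl_supp (v + w) \<subseteq> weyl_supp v \<union> weyl_supp w"
  unfolding weyl_supp_def weyl_coeffs_add by (rule keys_add)

lemma weyl_supp_diff: "weyl_supp (v - w) \<subseteq> weyl_supp v \<union> weyl_supp w"
  unfolding weyl_supp_def weyl_coeffs_diff by (rule keys_diff)

lemma weyl_supp_scalar: "weyl_supp (weyl_scalar c * w) \<subseteq> weyl_supp w"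
proof
  fix k assume "k \<in> weyl_supp (weyl_scalar c * w)"
  then obtain a b where "k = a + b" "a \<in> Poly_Mapping.keys (Poly_Mapping.single 0 c)" "b \<in> weyl_supp w"
    using keys_mult[of "Poly_Mapping.single 0 c" "weyl_coeffs w"]
    unfolding weyl_supp_def weyl_coeffs_scalar by blast
  then show "k \<in> weyl_supp w" by (simp split: if_splits)
qed

lemma weyl_supp_sum: "weyl_supp (sum f A) \<subseteq> (\<Union>a\<in>A. weyl_supp (f a))"
  unfolding weyl_supp_def weyl_coeffs_sum by (rule keys_sum)

lemma lookup_single_mult:
  fixes p :: "('n, 'k::comm_ring_1) poly_XY"
  shows "Poly_Mapping.lookup (Poly_Mapping.single m c * p) (m + k) = c * Poly_Mapping.lookup p k"
  by (induction p rule: single_induct_poly)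
    (auto simp: mult_single lookup_single when_def distrib_left lookup_add)

lemma poly_mapping_sum_single: "(\<Sum>k\<in>Poly_Mapping.keys p. Poly_Mapping.single k (Poly_Mapping.lookup p k)) = p"
  by (intro poly_mapping_eqI) (auto simp: lookup_sum lookup_single when_def in_keys_iff)

text \<open>
  Commuting \<open>\<partial>\<^sub>i\<close> past \<open>\<xi>\<^sub>i\<close> leaves a term with one \<open>\<xi>\<^sub>i\<close> and one \<open>\<partial>\<^sub>i\<close> fewer, so every correction term in
  a product has an exponent that is \<open>diag_less\<close> than the commutative one.
\<close>

definition diag_less :: "'n biexponent \<Rightarrow> 'n biexponent \<Rightarrow> bool" where
  "diag_less a t \<longleftrightarrow> (\<exists>s. s \<noteq> 0 \<and> a + (s, s) = t)"

lemma diag_less_trans: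
  assumes "diag_less a b" "diag_less b c"
  shows "diag_less a c"
proof -
  obtain s s' where s: "s \<noteq> 0" and eq: "b = a + (s, s)" "c = b + (s', s')"
    using assms unfolding diag_less_def by blast
  have "s + s' \<noteq> 0"
    using s by (auto simp: poly_mapping_eq_iff fun_eq_iff lookup_add)
  moreover have "a + (s + s', s + s') = c"
    unfolding eq by (simp only: add_Pair[symmetric] add.assoc)
  ultimately show ?thesis unfolding diag_less_def by blast
qed

lemma diag_less_add:
  assumes "diag_less a b"
  shows "diag_less (a + c) (b + c)"
proof -
  obtain s where s: "s \<noteq> 0" "b = a + (s, s)"
    using assms unfolding diag_less_def by blast
  then have "a + c + (s, s) = b + c" by (simp only: add_ac)
  with s(1) show ?thesis unfolding diag_less_def by blast
qed

definition weyl_below :: "'n biexponent \<Rightarrow> ('n::finite, 'k::field_char_0) weyl set" where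
  "weyl_below t = {w. \<forall>a\<in>weyl_supp w. diag_less a t}"

lemma weyl_below_add: "v \<in> weyl_below t \<Longrightarrow> w \<in> weyl_below t \<Longrightarrow> v + w \<in> weyl_below t"
  using weyl_supp_add[of v w] by (auto simp: weyl_below_def)

lemma weyl_below_sum: "(\<And>a. a \<in> A \<Longrightarrow> f a \<in> weyl_below t) \<Longrightarrow> sum f A \<in> weyl_below t"
  using weyl_supp_sum[of f A] by (fastforce simp: weyl_below_def)

lemma weyl_below_scalar: "w \<in> weyl_below t \<Longrightarrow> weyl_scalar c * w \<in> weyl_below t"
  using weyl_supp_scalar[of c w] by (auto simp: weyl_below_def)

lemma weyl_below_trans: "w \<in> weyl_below s \<Longrightarrow> diag_less s t \<Longrightarrow> w \<in> weyl_below t"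
  by (auto simp: weyl_below_def intro: diag_less_trans)

lemma weyl_below_zero [simp]: "0 \<in> weyl_below t"
  by (simp add: weyl_below_def)

lemma weyl_term_below: "c = 0 \<or> diag_less a t \<Longrightarrow> weyl_scalar c * weyl_monom a \<in> weyl_below t"
  by (simp add: weyl_below_def weyl_supp_def) blast

lemma weyl_expansion:
  "w = (\<Sum>a\<in>weyl_supp w. weyl_scalar (Poly_Mapping.lookup (weyl_coeffs w) a) * weyl_monom a)"
  using weyl_of_coeffs_coeffs[of w] unfolding weyl_of_coeffs_def weyl_supp_def by simp

lemma xi_weyl_monom: "weyl_xi i * weyl_monom m = weyl_monom ((Poly_Mapping.single i 1, 0) + m)"
  by (cases m) (simp add: weyl_monom_def weyl_prod_xi[simplified] mult.assoc)

lemma del_weyl_monom: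
  fixes m :: "'n::finite biexponent"
  shows "weyl_del i * weyl_monom m - weyl_monom ((0, Poly_Mapping.single i 1) + m)
     \<in> (weyl_below ((0, Poly_Mapping.single i 1) + m) :: ('n, 'k::field_char_0) weyl set)"
proof (cases m)
  case (Pair a b)
  let ?e = "Poly_Mapping.single i (1::nat)"
  have "weyl_del i * weyl_monom m =
      ((weyl_del i :: ('n, 'k) weyl) * weyl_prod weyl_xi a) * weyl_prod weyl_del b"
    by (simp add: weyl_monom_def mult.assoc Pair)
  also have "\<dots> = weyl_monom ((0, ?e) + m) +
    weyl_scalar (of_nat (Poly_Mapping.lookup a i)) * weyl_monom (a - ?e, b)"
    unfolding del_xi weyl_monom_def Pair add_Pair fst_conv snd_conv weyl_prod_del
    by (simp add: distrib_left distrib_right mult.assoc)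
  finally have eq: "weyl_del i * weyl_monom m - weyl_monom ((0, ?e) + m) =
    (weyl_scalar :: 'k \<Rightarrow> ('n, 'k) weyl) (of_nat (Poly_Mapping.lookup a i)) * weyl_monom (a - ?e, b)"
    by (simp only: add_diff_cancel_left')
  have "diag_less (a - ?e, b) ((0, ?e) + m)" if "Poly_Mapping.lookup a i \<noteq> 0"
  proof -
    from that have "a - ?e + ?e = a"
      by (intro poly_mapping_eqI) (auto simp: lookup_add lookup_minus lookup_single when_def)
    then have "(a - ?e, b) + (?e, ?e) = (0, ?e) + m" by (simp add: Pair add.commute)
    moreover have "?e \<noteq> 0" by (simp add: poly_mapping_eq_iff fun_eq_iff lookup_single when_def)
    ultimately show "diag_less (a - ?e, b) ((0, ?e) + m)" unfolding diag_less_def by blast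
  qed
  then show ?thesis unfolding eq by (intro weyl_term_below) auto
qed

text \<open>
  The property assumed of \<open>v\<close>, to act on monomials like a shift of exponents by \<open>c\<close> up to diagonally
  smaller terms, holds for \<open>\<partial>\<^sub>i\<close> and for \<open>\<xi>\<^sup>\<alpha>\<close>. It carries error terms along, which is what the
  induction over the factors of a monomial needs.
\<close>

lemma left_mult_below:
  assumes "\<And>a. v * weyl_monom a - weyl_monom (c + a) \<in> weyl_below (c + a)"
    and "w \<in> weyl_below t"
  shows "v * w \<in> weyl_below (c + t)"
proof -
  have "v * (weyl_scalar x * weyl_monom a) \<in> weyl_below (c + t)" if "a \<in> weyl_supp w" for x a
  proof -
    have "diag_less (c + a) (c + t)"
      using assms(2) that diag_less_add[of a t c] by (auto simp: weyl_below_def add.commute)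
    then have "(v * weyl_monom a - weyl_monom (c + a)) + weyl_scalar 1 * weyl_monom (c + a) \<in> weyl_below (c + t)"
      by (intro weyl_below_add weyl_term_below weyl_below_trans[OF assms(1)]) auto
    then have "weyl_scalar x * (v * weyl_monom a) \<in> weyl_below (c + t)"
      by (intro weyl_below_scalar) simp
    then show ?thesis by (simp add: mult.assoc[symmetric] weyl_scalar_commute[of x v])
  qed
  then have "(\<Sum>a\<in>weyl_supp w. v * (weyl_scalar (Poly_Mapping.lookup (weyl_coeffs w) a) * weyl_monom a)) \<in> weyl_below (c + t)"
    by (intro weyl_below_sum)
  then show ?thesis unfolding sum_distrib_left[symmetric] weyl_expansion[symmetric] .
qed

lemma weyl_monom_mult:
  fixes l m :: "'n::finite biexponent"
  shows "weyl_monom l * weyl_monom m - weyl_monom (l + m) \<in>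
    (weyl_below (l + m) :: ('n, 'k::field_char_0) weyl set)"
proof -
  let ?del = "weyl_del :: 'n \<Rightarrow> ('n, 'k) weyl"
  let ?xi = "weyl_xi :: 'n \<Rightarrow> ('n, 'k) weyl"
  have D: "weyl_prod ?del b * weyl_monom m - weyl_monom ((0, b) + m) \<in> weyl_below ((0, b) + m)" for b m
  proof (induction b rule: expo_induct)
    case (2 i b)
    let ?e = "Poly_Mapping.single i (1::nat)"
    let ?r = "weyl_prod ?del b * weyl_monom m - weyl_monom ((0, b) + m)"
    have "weyl_prod ?del (?e + b) * weyl_monom m - weyl_monom ((0, ?e) + ((0, b) + m)) =
        weyl_del i * ?r + (weyl_del i * weyl_monom ((0, b) + m) - weyl_monom ((0, ?e) + ((0, b) + m)))"
      unfolding weyl_prod_del by (simp add: algebra_simps)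
    also have "\<dots> \<in> weyl_below ((0, ?e) + ((0, b) + m))"
      by (intro weyl_below_add left_mult_below 2 del_weyl_monom)
    finally show ?case by (simp add: add.assoc[symmetric])
  qed (simp add: zero_prod_def[symmetric])
  have X: "weyl_prod ?xi a * weyl_monom m = weyl_monom ((a, 0) + m)" for a m
  proof (induction a rule: expo_induct)
    case (2 i a)
    then show ?case
      unfolding weyl_prod_xi mult.assoc by (simp add: xi_weyl_monom add.assoc[symmetric])
  qed (simp add: zero_prod_def[symmetric])
  obtain a b where l: "l = (a, b)" by (cases l)
  have "weyl_monom l * weyl_monom m - weyl_monom (l + m) =
     weyl_prod ?xi a * (weyl_prod ?del b * weyl_monom m - weyl_monom ((0, b) + m))"
    by (simp add: right_diff_distrib X add.assoc[symmetric] l) (simp add: weyl_monom_def mult.assoc)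
  also have "\<dots> \<in> weyl_below ((a, 0) + ((0, b) + m))"
    by (intro left_mult_below D) (simp add: X)
  finally show ?thesis by (simp add: l add.assoc[symmetric])
qed

text \<open>
  The bilinear extension of \<open>weyl_monom_mult\<close>. The subtracted product is the commutative one, in
  \<open>K[X,Y]\<close>.
\<close>

lemma weyl_coeffs_mult:
  assumes "k \<in> Poly_Mapping.keys (weyl_coeffs (v * w) - weyl_coeffs v * weyl_coeffs w)"
  shows "\<exists>a\<in>weyl_supp v. \<exists>b\<in>weyl_supp w. diag_less k (a + b)"
proof -
  define f where "f = Poly_Mapping.lookup (weyl_coeffs v)"
  define g where "g = Poly_Mapping.lookup (weyl_coeffs w)"
  define h :: "_ \<Rightarrow> _ \<Rightarrow> ('a, 'b) weyl" where
    "h a b = weyl_scalar (f a * g b) * (weyl_monom a * weyl_monom b - weyl_monom (a + b))" for a b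
  have "v * w = (\<Sum>a\<in>weyl_supp v. weyl_scalar (f a) * weyl_monom a) * (\<Sum>b\<in>weyl_supp w. weyl_scalar (g b) * weyl_monom b)"
    using weyl_expansion[of v] weyl_expansion[of w] by (simp add: f_def g_def)
  also have "\<dots> = (\<Sum>a\<in>weyl_supp v. \<Sum>b\<in>weyl_supp w. weyl_scalar (f a * g b) * (weyl_monom a * weyl_monom b))"
    unfolding sum_product
  proof (intro sum.cong refl)
    fix a b
    have "weyl_scalar (f a) * weyl_monom a * (weyl_scalar (g b) * weyl_monom b) =
        weyl_scalar (f a) * (weyl_monom a * weyl_scalar (g b)) * weyl_monom b"
      by (simp only: mult.assoc)
    also have "\<dots> = weyl_scalar (f a * g b) * (weyl_monom a * weyl_monom b)"
      unfolding weyl_scalar_commute[of "g b" "weyl_monom a", symmetric] weyl_scalar_mult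
      by (simp only: mult.assoc)
    finally show "weyl_scalar (f a) * weyl_monom a * (weyl_scalar (g b) * weyl_monom b) =
        weyl_scalar (f a * g b) * (weyl_monom a * weyl_monom b)" .
  qed
  also have "\<dots> = (\<Sum>a\<in>weyl_supp v. \<Sum>b\<in>weyl_supp w. h a b) +
      (\<Sum>a\<in>weyl_supp v. \<Sum>b\<in>weyl_supp w. weyl_scalar (f a * g b) * weyl_monom (a + b))"
    unfolding sum.distrib[symmetric] h_def by (simp add: right_diff_distrib)
  finally have "weyl_coeffs (v * w) = weyl_coeffs (\<Sum>a\<in>weyl_supp v. \<Sum>b\<in>weyl_supp w. h a b) +
      (\<Sum>a\<in>weyl_supp v. \<Sum>b\<in>weyl_supp w. Poly_Mapping.single (a + b) (f a * g b))"
    by (simp add: weyl_coeffs_sum weyl_coeffs_term)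
  also have "(\<Sum>a\<in>weyl_supp v. \<Sum>b\<in>weyl_supp w. Poly_Mapping.single (a + b) (f a * g b)) = weyl_coeffs v * weyl_coeffs w"
    unfolding mult_single[symmetric] sum_product[symmetric] f_def g_def weyl_supp_def poly_mapping_sum_single ..
  finally have "k \<in> weyl_supp (\<Sum>a\<in>weyl_supp v. \<Sum>b\<in>weyl_supp w. h a b)"
    using assms by (simp add: weyl_supp_def)
  then obtain a where a: "a \<in> weyl_supp v" "k \<in> weyl_supp (\<Sum>b\<in>weyl_supp w. h a b)"
    using weyl_supp_sum by blast
  then obtain b where ab: "b \<in> weyl_supp w" "k \<in> weyl_supp (h a b)"
    using weyl_supp_sum by blast
  have "h a b \<in> weyl_below (a + b)"
    unfolding h_def by (intro weyl_below_scalar weyl_monom_mult)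
  with a ab show ?thesis by (auto simp: weyl_below_def)
qed

section \<open>Dickson's lemma and normal orderings\<close>

text \<open>
  Exponents are pairs, but they are treated as single objects below, so quantifiers over them should
  not be split.
\<close>

declare split_paired_All [simp del] split_paired_Ex [simp del]

lemma nat_seq_mono_subseq:
  fixes f :: "nat \<Rightarrow> nat"
  shows "\<exists>\<phi> :: nat \<Rightarrow> nat. strict_mono \<phi> \<and> mono (\<lambda>n. f (\<phi> n))"
proof -
  obtain \<phi> where \<phi>: "strict_mono \<phi>" "monoseq (\<lambda>n. f (\<phi> n))"
    using seq_monosub[of f] by blast
  show ?thesis
  proof (cases "mono (\<lambda>n. f (\<phi> n))")
    case False
    \<comment> \<open>a nonincreasing sequence of natural numbers is constant from its minimum on\<close>
    then have dec: "decseq (\<lambda>n. f (\<phi> n))" using \<phi>(2) by (simp add: monoseq_iff)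
    obtain k where k: "\<And>n. f (\<phi> k) \<le> f (\<phi> n)"
      using ex_has_least_nat[of "\<lambda>_. True" 0 "\<lambda>n. f (\<phi> n)"] by auto
    have "f (\<phi> (k + n)) = f (\<phi> k)" for n
      using decseqD[OF dec, of k "k + n"] k[of "k + n"] by simp
    then have "mono (\<lambda>n. f (\<phi> (k + n)))" by (simp add: mono_def)
    moreover have "strict_mono (\<lambda>n. \<phi> (k + n))"
      using \<phi>(1) by (simp add: strict_mono_def)
    ultimately show ?thesis by blast
  qed (use \<phi>(1) in blast)
qed

lemma mono_subseq_finite:
  fixes g :: "nat \<Rightarrow> 'i \<Rightarrow> nat"
  assumes "finite A"
  shows "\<exists>\<phi> :: nat \<Rightarrow> nat. strict_mono \<phi> \<and> (\<forall>i\<in>A. mono (\<lambda>n. g (\<phi> n) i))"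
  using assms
proof induction
  case empty
  show ?case by (rule exI[of _ id]) (simp add: strict_mono_def)
next
  case (insert i A)
  then obtain \<phi> :: "nat \<Rightarrow> nat" where \<phi>: "strict_mono \<phi>" "\<And>i. i \<in> A \<Longrightarrow> mono (\<lambda>n. g (\<phi> n) i)" by blast
  obtain \<psi> :: "nat \<Rightarrow> nat" where \<psi>: "strict_mono \<psi>" "mono (\<lambda>n. g (\<phi> (\<psi> n)) i)"
    using nat_seq_mono_subseq[of "\<lambda>n. g (\<phi> n) i"] by blast
  have "mono (\<lambda>n. g (\<phi> (\<psi> n)) j)" if "j \<in> A" for j
    using \<phi>(2)[OF that] strict_mono_mono[OF \<psi>(1)] by (simp add: mono_def)
  moreover have "strict_mono (\<lambda>n. \<phi> (\<psi> n))"
    using \<phi>(1) \<psi>(1) by (simp add: strict_mono_def)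
  ultimately show ?case using \<psi>(2) by blast
qed

text \<open>
  Passing to a subsequence along which all of the finitely many coordinates are nondecreasing shows
  that any two of its members are comparable by divisibility.
\<close>

lemma dickson:
  fixes g :: "nat \<Rightarrow> 'n::finite biexponent"
  shows "\<exists>i j c. i < j \<and> g j = g i + c"
proof -
  define coord where "coord m = case_sum (Poly_Mapping.lookup (fst m)) (Poly_Mapping.lookup (snd m))"
    for m :: "'n biexponent"
  obtain \<phi> :: "nat \<Rightarrow> nat" where \<phi>: "strict_mono \<phi>" "\<And>i. mono (\<lambda>n. coord (g (\<phi> n)) i)"
    using mono_subseq_finite[of UNIV "\<lambda>n. coord (g n)"] by auto
  have le: "coord (g (\<phi> 0)) i \<le> coord (g (\<phi> 1)) i" for i
    using monoD[OF \<phi>(2), of 0 1 i] by simp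
  have "\<phi> 0 < \<phi> 1" using \<phi>(1) by (simp add: strict_mono_def)
  moreover have "g (\<phi> 1) = g (\<phi> 0) + (fst (g (\<phi> 1)) - fst (g (\<phi> 0)), snd (g (\<phi> 1)) - snd (g (\<phi> 0)))"
    using le[of "Inl _"] le[of "Inr _"]
    by (intro prod_eqI poly_mapping_eqI) (simp_all add: coord_def lookup_add lookup_minus)
  ultimately show ?thesis by blast
qed

definition up_closed :: "'n biexponent set \<Rightarrow> bool" where
  "up_closed J \<longleftrightarrow> (\<forall>m\<in>J. \<forall>c. m + c \<in> J)"

lemma up_closedD: "up_closed J \<Longrightarrow> m \<in> J \<Longrightarrow> m + c \<in> J"
  by (simp only: up_closed_def)

text \<open>
  The ascending chain condition for monomial ideals, in terms of their sets of exponents. Picking a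
  new exponent at each step of a chain would contradict Dickson's lemma.
\<close>

lemma wf_up_closed: "wf {(J', J :: 'n::finite biexponent set). up_closed J' \<and> J \<subset> J'}"
proof (subst wf_iff_no_infinite_down_chain, rule notI, elim exE)
  fix f :: "nat \<Rightarrow> 'n biexponent set"
  assume f: "\<forall>i. (f (Suc i), f i) \<in> {(J', J). up_closed J' \<and> J \<subset> J'}"
  then have up: "up_closed (f (Suc i))" and sub: "f i \<subset> f (Suc i)" for i by simp_all
  from sub have "\<exists>m. m \<in> f (Suc i) \<and> m \<notin> f i" for i by blast
  then obtain g where g: "\<And>i. g i \<in> f (Suc i)" "\<And>i. g i \<notin> f i" by metis
  obtain i j c where ij: "i < j" "g j = g i + c" using dickson[of g] by blast
  have "g j \<in> f (Suc i)" unfolding ij(2) using up g(1) by (rule up_closedD)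
  moreover have "f (Suc i) \<subseteq> f j"
    by (rule lift_Suc_mono_le[of f]) (use sub ij(1) in auto)
  ultimately show False using g(2)[of j] by blast
qed

locale normal_order =
  fixes r :: "('n::finite biexponent \<times> 'n biexponent) set"
  assumes normal: "normal_ordering r"
begin

abbreviation le (infix "\<preceq>" 50) where "a \<preceq> b \<equiv> (a, b) \<in> r"
abbreviation lt (infix "\<prec>" 50) where "a \<prec> b \<equiv> a \<preceq> b \<and> a \<noteq> b"

lemma le_refl [simp]: "a \<preceq> a"
  and le_trans: "a \<preceq> b \<Longrightarrow> b \<preceq> c \<Longrightarrow> a \<preceq> c"
  and le_antisym: "a \<preceq> b \<Longrightarrow> b \<preceq> a \<Longrightarrow> a = b"
  and le_total: "a \<preceq> b \<or> b \<preceq> a"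
  and zero_le: "0 \<preceq> a"
  and add_le: "a \<preceq> b \<Longrightarrow> a + c \<preceq> b + c"
proof -
  have l: "linear_order r" and z: "\<And>a. (0, a) \<in> r" and m: "\<And>a b c. (a, b) \<in> r \<Longrightarrow> (a + c, b + c) \<in> r"
    using normal by (simp_all add: normal_ordering_def)
  then have re: "refl r" and tr: "trans r" and an: "antisym r" and tot: "total r"
    by (simp_all add: linear_order_on_def partial_order_on_def preorder_on_def)
  show re': "a \<preceq> a" for a using re by (rule reflD)
  show "a \<preceq> b \<Longrightarrow> b \<preceq> c \<Longrightarrow> a \<preceq> c" using tr by (rule transD)
  show "a \<preceq> b \<Longrightarrow> b \<preceq> a \<Longrightarrow> a = b" using an by (rule antisymD)
  show "a \<preceq> b \<or> b \<preceq> a" using tot re' by (metis UNIV_I total_on_def)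
  show "0 \<preceq> a" "a \<preceq> b \<Longrightarrow> a + c \<preceq> b + c" by (fact z, fact m)
qed

lemma le_add: "a \<preceq> a + c"
  using add_le[OF zero_le[of c], of a] by (simp add: add.commute)

lemma lt_trans: "a \<prec> b \<Longrightarrow> b \<preceq> c \<Longrightarrow> a \<prec> c"
  using le_trans le_antisym by blast

text \<open>
  A normal ordering extends divisibility, so a descending sequence contradicts Dickson's lemma.
\<close>

lemma wf_lt: "wf {(a, b). a \<prec> b}"
proof (subst wf_iff_no_infinite_down_chain, rule notI, elim exE)
  fix f :: "nat \<Rightarrow> 'n biexponent"
  assume "\<forall>i. (f (Suc i), f i) \<in> {(a, b). a \<prec> b}"
  then have f: "f (Suc i) \<prec> f i" for i by blast
  obtain i j c where ij: "i < j" "f j = f i + c" using dickson[of f] by blast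
  have "f j \<prec> f i" using ij(1)
  proof (induction j rule: less_Suc_induct)
    case (1 i) show ?case by (rule f)
  next
    case (2 i j k) then show ?case using lt_trans by blast
  qed
  then show False using le_add[of "f i" c] ij(2) le_antisym by metis
qed

lemma diag_less_lt: "diag_less a b \<Longrightarrow> a \<prec> b"
  unfolding diag_less_def using le_add by (metis add_cancel_right_right fst_conv fst_zero)

abbreviation lead :: "('n, 'k::field_char_0) weyl \<Rightarrow> 'n biexponent" where
  "lead w \<equiv> lead_exponent r w"

lemma lead_eqI:
  assumes "a \<in> weyl_supp w" "\<And>b. b \<in> weyl_supp w \<Longrightarrow> b \<preceq> a"
  shows "lead w = a"
  unfolding lead_exponent_def using assms by (intro the_equality) (auto intro: le_antisym)

lemma lead:
  assumes "w \<noteq> 0"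
  shows "lead w \<in> weyl_supp w" "\<And>b. b \<in> weyl_supp w \<Longrightarrow> b \<preceq> lead w"
proof -
  have "\<exists>a\<in>A. \<forall>b\<in>A. b \<preceq> a" if "finite A" "A \<noteq> {}" for A
    using that
  proof (induction rule: finite_ne_induct)
    case (insert x A)
    then obtain a where a: "a \<in> A" "\<forall>b\<in>A. b \<preceq> a" by blast
    show ?case
    proof (cases "x \<preceq> a")
      case False
      then have "a \<preceq> x" using le_total by blast
      then have "\<forall>b\<in>insert x A. b \<preceq> x" using a(2) le_trans[of _ a x] by simp
      then show ?thesis by blast
    qed (use a in blast)
  qed simp
  from this[of "weyl_supp w"] assms obtain a where
    a: "a \<in> weyl_supp w" "\<forall>b\<in>weyl_supp w. b \<preceq> a" by auto
  then have "lead w = a" by (intro lead_eqI) auto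
  with a show "lead w \<in> weyl_supp w" "\<And>b. b \<in> weyl_supp w \<Longrightarrow> b \<preceq> lead w" by auto
qed

lemma lead_coeff_nonzero: "w \<noteq> 0 \<Longrightarrow> Poly_Mapping.lookup (weyl_coeffs w) (lead w) \<noteq> 0"
  using lead(1)[of w] by (simp add: weyl_supp_def in_keys_iff)

text \<open>
  Leading exponents are defined for nonzero elements only, whence the separate case for 0.
\<close>

lemma lead_induct [case_names zero nonzero]:
  assumes "P 0"
    and step: "\<And>w. w \<noteq> 0 \<Longrightarrow> (\<And>v. v \<noteq> 0 \<Longrightarrow> lead v \<prec> lead w \<Longrightarrow> P v) \<Longrightarrow> P w"
  shows "P w"
proof (cases "w = 0")
  case False
  then show ?thesis
  proof (induction "lead w" arbitrary: w rule: wf_induct_rule[OF wf_lt])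
    case 1
    then show ?case using step by blast
  qed
qed (use assms(1) in simp)

lemma lead_diff:
  assumes "\<And>b. b \<in> weyl_supp v \<Longrightarrow> b \<preceq> a" "\<And>b. b \<in> weyl_supp w \<Longrightarrow> b \<preceq> a"
    and "Poly_Mapping.lookup (weyl_coeffs v) a = Poly_Mapping.lookup (weyl_coeffs w) a"
    and "v - w \<noteq> 0"
  shows "lead (v - w) \<prec> a"
proof -
  have "lead (v - w) \<preceq> a"
    using lead(1)[OF assms(4)] weyl_supp_diff assms(1,2) by blast
  moreover have "a \<notin> weyl_supp (v - w)"
    using assms(3) by (simp add: weyl_supp_def in_keys_iff lookup_minus)
  ultimately show ?thesis using lead(1)[OF assms(4)] by blast
qed

text \<open>
  Left multiplication by a monomial shifts the leading term as in the commutative ring, because the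
  correction terms are diagonally smaller and hence smaller in the ordering.
\<close>

lemma monom_mult_lead:
  fixes w :: "('n, 'a::field_char_0) weyl"
  assumes "w \<noteq> 0"
  shows "\<And>a. a \<in> weyl_supp (weyl_monom b * w) \<Longrightarrow> a \<preceq> b + lead w"
    and "Poly_Mapping.lookup (weyl_coeffs (weyl_monom b * w)) (b + lead w) =
      Poly_Mapping.lookup (weyl_coeffs w) (lead w)"
proof -
  let ?q = "weyl_coeffs (weyl_monom b * w) - Poly_Mapping.single b 1 * weyl_coeffs w"
  have q: "a \<prec> b + lead w" if a: "a \<in> Poly_Mapping.keys ?q" for a
  proof -
    have "a \<in> Poly_Mapping.keys (weyl_coeffs (weyl_monom b * w) - weyl_coeffs (weyl_monom b) * weyl_coeffs w)"
      using a by simp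
    from weyl_coeffs_mult[OF this] obtain c where c: "c \<in> weyl_supp w" "diag_less a (b + c)"
      by (auto simp: weyl_supp_def)
    have "b + c \<preceq> b + lead w"
      using add_le[OF lead(2)[OF assms c(1)], of b] by (simp add: add.commute)
    with diag_less_lt[OF c(2)] show ?thesis by (rule lt_trans)
  qed
  have eq: "weyl_coeffs (weyl_monom b * w) = Poly_Mapping.single b 1 * weyl_coeffs w + ?q" by simp
  show "a \<preceq> b + lead w" if a: "a \<in> weyl_supp (weyl_monom b * w)" for a
  proof -
    have "weyl_supp (weyl_monom b * w) \<subseteq>
        Poly_Mapping.keys (Poly_Mapping.single b 1 * weyl_coeffs w) \<union> Poly_Mapping.keys ?q"
      unfolding weyl_supp_def by (subst eq) (rule keys_add)
    with a consider "a \<in> Poly_Mapping.keys (Poly_Mapping.single b 1 * weyl_coeffs w)" |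
      "a \<in> Poly_Mapping.keys ?q" by blast
    then show ?thesis
    proof cases
      case 1
      then obtain d c where "a = d + c" "d \<in> Poly_Mapping.keys (Poly_Mapping.single b (1::'a))" "c \<in> weyl_supp w"
        using keys_mult[of "Poly_Mapping.single b (1::'a)" "weyl_coeffs w"]
        unfolding weyl_supp_def by blast
      then have "a = c + b" "c \<in> weyl_supp w" by (simp_all add: add.commute)
      then show ?thesis using add_le[OF lead(2)[OF assms, of c], of b] by (simp add: add.commute)
    next
      case 2
      then show ?thesis using q by blast
    qed
  qed
  have "Poly_Mapping.lookup ?q (b + lead w) = 0"
    using q[of "b + lead w"] unfolding in_keys_iff by blast
  then show "Poly_Mapping.lookup (weyl_coeffs (weyl_monom b * w)) (b + lead w) =
      Poly_Mapping.lookup (weyl_coeffs w) (lead w)"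
    by (subst eq, subst lookup_add) (simp add: lookup_single_mult)
qed

text \<open>
  The reduction step of the division algorithm.
\<close>

lemma lead_cancel:
  assumes "x \<noteq> 0" "u \<noteq> 0" "lead x = b + lead u"
  shows "\<exists>c. x - weyl_scalar c * weyl_monom b * u = 0 \<or>
     lead (x - weyl_scalar c * weyl_monom b * u) \<prec> lead x"
proof -
  define c where "c = Poly_Mapping.lookup (weyl_coeffs x) (lead x) / Poly_Mapping.lookup (weyl_coeffs u) (lead u)"
  have *: "Poly_Mapping.lookup (Poly_Mapping.single 0 c * p) k = c * Poly_Mapping.lookup p k"
    for k and p :: "('n, 'a) poly_XY"
    using lookup_single_mult[of 0 c p k] by simp
  have "lead (x - weyl_scalar c * (weyl_monom b * u)) \<prec> lead x"
    if "x - weyl_scalar c * (weyl_monom b * u) \<noteq> 0"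
  proof (rule lead_diff[OF _ _ _ that])
    show "a \<preceq> lead x" if "a \<in> weyl_supp (weyl_scalar c * (weyl_monom b * u))" for a
      using monom_mult_lead(1)[OF assms(2), of a b] subsetD[OF weyl_supp_scalar that]
      unfolding assms(3) by simp
    show "Poly_Mapping.lookup (weyl_coeffs x) (lead x) =
      Poly_Mapping.lookup (weyl_coeffs (weyl_scalar c * (weyl_monom b * u))) (lead x)"
      unfolding weyl_coeffs_scalar *
      using monom_mult_lead(2)[OF assms(2), of b] lead_coeff_nonzero[OF assms(2)]
      by (simp add: c_def assms(3))
  qed (rule lead(2)[OF assms(1)])
  then show ?thesis unfolding mult.assoc by blast
qed

end

section \<open>Existence of universal Groebner bases\<close>

lemma K_XY_simps [simp]:
  "carrier K_XY = UNIV" "x \<oplus>\<^bsub>K_XY\<^esub> y = x + y" "x \<otimes>\<^bsub>K_XY\<^esub> y = x * y"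
  "\<zero>\<^bsub>K_XY\<^esub> = 0" "\<one>\<^bsub>K_XY\<^esub> = 1"
  by (simp_all add: ring_of_type_algebra_def)

lemma cring_K_XY: "cring (K_XY :: ('n, 'k::comm_ring_1) poly_XY ring)"
  by (rule cring_from_type_algebra)

interpretation K_XY: cring "K_XY :: ('n, 'k::comm_ring_1) poly_XY ring"
  by (rule cring_K_XY)

lemma K_XY_idealI:
  fixes I :: "('n, 'k::comm_ring_1) poly_XY set"
  assumes "0 \<in> I" "\<And>x y. x \<in> I \<Longrightarrow> y \<in> I \<Longrightarrow> x + y \<in> I" "\<And>x y. y \<in> I \<Longrightarrow> x * y \<in> I"
  shows "ideal I K_XY"
proof (rule idealI)
  show "ring (K_XY :: ('n, 'k) poly_XY ring)" by (rule K_XY.ring_axioms)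
  have "\<ominus>\<^bsub>K_XY\<^esub> x = - x" for x :: "('n, 'k) poly_XY"
    by (rule K_XY.minus_equality) simp_all
  then show "subgroup I (add_monoid (K_XY :: ('n, 'k) poly_XY ring))"
    using assms(1,2) assms(3)[of _ "-1"]
    by (intro K_XY.add.subgroupI) auto
qed (use assms(3) in \<open>auto simp: mult.commute\<close>)

lemma K_XY_ideal_mult: "ideal I K_XY \<Longrightarrow> y \<in> I \<Longrightarrow> x * y \<in> I"
  using ideal.I_l_closed[of I K_XY y x] by simp

lemma K_XY_ideal_add: "ideal I K_XY \<Longrightarrow> x \<in> I \<Longrightarrow> y \<in> I \<Longrightarrow> x + y \<in> I"
  using additive_subgroup.a_closed[OF ideal.axioms(1), of I K_XY x y] by simp

lemma K_XY_ideal_zero: "ideal I K_XY \<Longrightarrow> 0 \<in> I"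
  using additive_subgroup.zero_closed[OF ideal.axioms(1), of I K_XY] by simp

lemma K_XY_ideal_sum: "ideal I K_XY \<Longrightarrow> (\<And>a. a \<in> A \<Longrightarrow> f a \<in> I) \<Longrightarrow> sum f A \<in> I"
  by (induction A rule: infinite_finite_induct) (auto simp: K_XY_ideal_zero K_XY_ideal_add)

text \<open>
  The polynomials all of whose exponents are divisible by one in \<open>S\<close> form an ideal containing the
  generators.
\<close>

lemma single_mem_monomial_ideal:
  fixes S :: "'n biexponent set"
  assumes "Poly_Mapping.single a (1::'k::comm_ring_1) \<in> Idl\<^bsub>K_XY\<^esub> ((\<lambda>s. Poly_Mapping.single s 1) ` S)"
  shows "\<exists>s\<in>S. \<exists>b. a = b + s"
proof -
  define J :: "('n, 'k) poly_XY set" where "J = {p. \<forall>k\<in>Poly_Mapping.keys p. \<exists>s\<in>S. \<exists>b. k = b + s}"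
  have "ideal J K_XY"
  proof (rule K_XY_idealI)
    fix x y assume y: "y \<in> J"
    {
      fix k assume "k \<in> Poly_Mapping.keys (x * y)"
      then obtain c d where cd: "k = c + d" "d \<in> Poly_Mapping.keys y" using keys_mult[of x y] by blast
      then obtain s b where "s \<in> S" "d = b + s" using y unfolding J_def by blast
      then have "s \<in> S" "k = (c + b) + s" using cd by (simp_all add: add.assoc)
      then have "\<exists>s\<in>S. \<exists>b. k = b + s" by blast
    }
    then show "x * y \<in> J" unfolding J_def by blast
  next
    fix x y assume "x \<in> J" "y \<in> J"
    then show "x + y \<in> J" using keys_add[of x y] unfolding J_def by blast
  qed (simp add: J_def)
  moreover have "(\<lambda>s. Poly_Mapping.single s 1) ` S \<subseteq> J"
  proof -
    have "\<exists>s'\<in>S. \<exists>b. s = b + s'" if "s \<in> S" for s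
      using that by (intro bexI[of _ s] exI[of _ 0]) simp_all
    then show ?thesis unfolding J_def
      by (intro image_subsetI CollectI) simp
  qed
  ultimately have "Poly_Mapping.single a 1 \<in> J" using K_XY.genideal_minimal assms by blast
  then show ?thesis by (simp add: J_def)
qed

text \<open>
  The combinatorial content of being a Groebner basis: for a finite subset of a left ideal the two
  notions agree (\<open>groebner_basis_lead_divisible\<close> and \<open>groebner_basisI\<close>).
\<close>

definition lead_divisible ::
    "('n biexponent \<times> 'n biexponent) set \<Rightarrow> ('n::finite, 'k::field_char_0) weyl set \<Rightarrow> ('n, 'k) weyl set \<Rightarrow> bool" where
  "lead_divisible r L U \<longleftrightarrow>
    (\<forall>x\<in>L - {0}. \<exists>u\<in>U - {0}. \<exists>b. lead_exponent r x = b + lead_exponent r u)"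

lemma left_ideal_diff:
  assumes "left_ideal L" "x \<in> L" "y \<in> L" shows "x - y \<in> L"
proof -
  have "x + (-1) * y \<in> L" using assms unfolding left_ideal_def by blast
  then show ?thesis by simp
qed

lemma left_ideal_sum: "left_ideal L \<Longrightarrow> (\<And>a. a \<in> A \<Longrightarrow> f a \<in> L) \<Longrightarrow> sum f A \<in> L"
  by (induction A rule: infinite_finite_induct) (auto simp: left_ideal_def)

lemma groebner_basis_lead_divisible:
  assumes "groebner_basis r L B" shows "lead_divisible r L B"
  unfolding lead_divisible_def
proof (rule ballI)
  fix x assume "x \<in> L - {0}"
  then have "lead_monomial r x \<in> Idl\<^bsub>K_XY\<^esub> (lead_monomial r ` (L - {0}))"
    using K_XY.genideal_self[of "lead_monomial r ` (L - {0})"] by auto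
  then have "lead_monomial r x \<in> Idl\<^bsub>K_XY\<^esub> (lead_monomial r ` (B - {0}))"
    using assms unfolding groebner_basis_def by argo
  moreover have "lead_monomial r ` (B - {0}) = (\<lambda>s. Poly_Mapping.single s 1) ` (lead_exponent r ` (B - {0}))"
    unfolding image_image lead_monomial_def ..
  ultimately show "\<exists>u\<in>B - {0}. \<exists>b. lead_exponent r x = b + lead_exponent r u"
    using single_mem_monomial_ideal[of "lead_exponent r x" "lead_exponent r ` (B - {0})"]
    unfolding lead_monomial_def by auto
qed

context normal_order
begin

lemma lead_monom_mult:
  assumes "w \<noteq> 0"
  shows "weyl_monom b * w \<noteq> 0" "lead (weyl_monom b * w) = b + lead w"
proof -
  have "b + lead w \<in> weyl_supp (weyl_monom b * w)"
    using monom_mult_lead(2)[OF assms, of b] lead_coeff_nonzero[OF assms]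
    by (simp add: weyl_supp_def in_keys_iff)
  then show "weyl_monom b * w \<noteq> 0" by (metis empty_iff weyl_supp_zero)
  show "lead (weyl_monom b * w) = b + lead w"
    by (rule lead_eqI) (fact, rule monom_mult_lead(1)[OF assms])
qed

text \<open>
  The division algorithm for elements of \<open>L\<close> as an induction principle: it terminates since leading
  exponents decrease, and it reaches 0 since the leading exponent of every element of \<open>L\<close> is
  divisible by that of an element of \<open>U\<close>.
\<close>

lemma division_induct [consumes 4, case_names zero step]:
  assumes "left_ideal L" "U \<subseteq> L" "lead_divisible r L U" "x \<in> L"
    and "P 0"
    and step: "\<And>x u b c. x \<in> L \<Longrightarrow> x \<noteq> 0 \<Longrightarrow> u \<in> U \<Longrightarrow> u \<noteq> 0 \<Longrightarrow> lead x = b + lead u \<Longrightarrow>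
        P (x - weyl_scalar c * weyl_monom b * u) \<Longrightarrow> P x"
  shows "P x"
  using \<open>x \<in> L\<close>
proof (induction x rule: lead_induct)
  case (nonzero x)
  then obtain u b where u: "u \<in> U" "u \<noteq> 0" "lead x = b + lead u"
    using assms(3) unfolding lead_divisible_def by blast
  obtain c where c: "x - weyl_scalar c * weyl_monom b * u = 0 \<or>
     lead (x - weyl_scalar c * weyl_monom b * u) \<prec> lead x"
    using lead_cancel[OF nonzero(1) u(2,3)] by blast
  have "x - weyl_scalar c * weyl_monom b * u \<in> L"
    using left_ideal_diff[OF assms(1) nonzero.prems] assms(1,2) u(1) unfolding left_ideal_def by blast
  then have "P (x - weyl_scalar c * weyl_monom b * u)"
    using c nonzero.IH assms(5) by metis
  then show ?case using step nonzero(1) nonzero.prems u by blast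
qed (rule assms(5))

lemma groebner_basisI:
  assumes L: "left_ideal L" and U: "finite U" "U \<subseteq> L" and div: "lead_divisible r L U"
  shows "groebner_basis r L U"
proof -
  have "\<exists>f. x = (\<Sum>u\<in>U. f u * u)" if "x \<in> L" for x
    using L U(2) div that
  proof (induction x rule: division_induct)
    case zero
    show ?case by (rule exI[of _ "\<lambda>_. 0"]) simp
  next
    case (step x u b c)
    then obtain f where f: "x - weyl_scalar c * weyl_monom b * u = (\<Sum>u\<in>U. f u * u)" by blast
    let ?w = "weyl_scalar c * weyl_monom b"
    have "(\<Sum>v\<in>U. (f v + (if v = u then ?w else 0)) * v) = (\<Sum>v\<in>U. f v * v) + (\<Sum>v\<in>U. if v = u then ?w * v else 0)"
      unfolding sum.distrib[symmetric] by (intro sum.cong) (auto simp: distrib_right)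
    also have "\<dots> = x" using U(1) step(3) f[symmetric] by simp
    finally show ?case by (intro exI[of _ "\<lambda>v. f v + (if v = u then ?w else 0)"]) (rule sym)
  qed
  moreover have "(\<Sum>u\<in>U. f u * u) \<in> L" for f
    using L U(2) by (intro left_ideal_sum) (auto simp: left_ideal_def)
  ultimately have gen: "L = {(\<Sum>b\<in>U. f b * b) | f. True}" by blast
  let ?I = "Idl\<^bsub>K_XY\<^esub> (lead_monomial r ` (U - {0}))"
  have I: "ideal ?I K_XY" by (rule K_XY.genideal_ideal) simp
  have "lead_monomial r x \<in> ?I" if x: "x \<in> L - {0}" for x
  proof -
    obtain u b where u: "u \<in> U - {0}" "lead x = b + lead u"
      using div x unfolding lead_divisible_def by blast
    have "lead_monomial r x = Poly_Mapping.single b 1 * lead_monomial r u"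
      by (simp add: lead_monomial_def mult_single u(2))
    moreover have "lead_monomial r u \<in> ?I"
      using K_XY.genideal_self[of "lead_monomial r ` (U - {0})"] u(1) by auto
    ultimately show ?thesis using K_XY_ideal_mult[OF I] by simp
  qed
  then have "Idl\<^bsub>K_XY\<^esub> (lead_monomial r ` (L - {0})) \<subseteq> ?I"
    by (intro K_XY.genideal_minimal I) auto
  moreover have "?I \<subseteq> Idl\<^bsub>K_XY\<^esub> (lead_monomial r ` (L - {0}))"
    using K_XY.genideal_self[of "lead_monomial r ` (L - {0})"] U(2)
    by (intro K_XY.genideal_minimal K_XY.genideal_ideal) auto
  ultimately show ?thesis using gen U unfolding groebner_basis_def by blast
qed

text \<open>
  Leading terms of \<open>w\<close> that occur as leading terms in \<open>L\<close> are cancelled, the others are moved to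
  \<open>v\<close>.
\<close>

lemma normal_form:
  assumes "left_ideal L"
  shows "\<exists>v. w - v \<in> L \<and> (\<forall>a\<in>weyl_supp v. \<forall>x\<in>L - {0}. lead x \<noteq> a)"
proof (induction w rule: lead_induct)
  case zero
  show ?case using assms by (intro exI[of _ 0]) (simp add: left_ideal_def)
next
  case (nonzero w)
  show ?case
  proof (cases "\<exists>x\<in>L - {0}. lead x = lead w")
    case True
    then obtain x where x: "x \<in> L" "x \<noteq> 0" "lead w = 0 + lead x"
      by (metis DiffE add_0 singletonI)
    obtain c where c: "w - weyl_scalar c * weyl_monom 0 * x = 0 \<or>
       lead (w - weyl_scalar c * weyl_monom 0 * x) \<prec> lead w" (is "?w = 0 \<or> _")
      using lead_cancel[OF nonzero(1) x(2,3)] by blast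
    have "\<exists>v. ?w - v \<in> L \<and> (\<forall>a\<in>weyl_supp v. \<forall>x\<in>L - {0}. lead x \<noteq> a)"
    proof (cases "?w = 0")
      case True
      then show ?thesis using assms by (intro exI[of _ 0]) (simp add: left_ideal_def)
    qed (use c nonzero.IH in blast)
    then obtain v where v: "?w - v \<in> L" "\<forall>a\<in>weyl_supp v. \<forall>x\<in>L - {0}. lead x \<noteq> a" by blast
    have "(?w - v) + weyl_scalar c * weyl_monom 0 * x \<in> L"
      using assms v(1) x(1) unfolding left_ideal_def by blast
    then have "w - v \<in> L" by (simp add: algebra_simps)
    with v(2) show ?thesis by blast
  next
    case False
    \<comment> \<open>the leading term is irreducible: it goes into the normal form, and the rest is reduced\<close>
    let ?t = "weyl_scalar (Poly_Mapping.lookup (weyl_coeffs w) (lead w)) * weyl_monom (lead w)"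
    have t: "weyl_supp ?t \<subseteq> {lead w}" by (simp add: weyl_supp_def)
    have "\<exists>v. w - ?t - v \<in> L \<and> (\<forall>a\<in>weyl_supp v. \<forall>x\<in>L - {0}. lead x \<noteq> a)"
    proof (cases "w - ?t = 0")
      case True
      then show ?thesis using assms by (intro exI[of _ 0]) (simp add: left_ideal_def)
    next
      case False
      then have "lead (w - ?t) \<prec> lead w"
        using lead(2)[OF nonzero(1)] t by (intro lead_diff) auto
      with False nonzero.IH show ?thesis by blast
    qed
    then obtain v where v: "w - ?t - v \<in> L" "\<forall>a\<in>weyl_supp v. \<forall>x\<in>L - {0}. lead x \<noteq> a" by blast
    have "w - (v + ?t) \<in> L" using v(1) by (simp add: algebra_simps)
    moreover have "\<forall>a\<in>weyl_supp (v + ?t). \<forall>x\<in>L - {0}. lead x \<noteq> a"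
      using weyl_supp_add[of v ?t] t v(2) False by blast
    ultimately show ?thesis by blast
  qed
qed

end

text \<open>
  The induction is on the up-closed set \<open>J\<close> of exponents that are divisible by leading exponents of
  \<open>F\<close> for all orderings in \<open>R\<close>, which can grow only finitely often. If \<open>F\<close> fails for an ordering \<open>r\<close>,
  take a monomial in the initial ideal for \<open>r\<close> that is not in \<open>J\<close>, and subtract its normal form
  modulo \<open>L\<close> for \<open>r\<close>. The difference \<open>f\<close> lies in \<open>L\<close>, and its support avoids \<open>J\<close>. So whatever the
  leading exponent of \<open>f\<close> is in another ordering, it enlarges \<open>J\<close>; the orderings are split according
  to this exponent into finitely many classes, to which the induction hypothesis applies.
\<close>

lemma universal_groebner_refinement:
  fixes L :: "('n::finite, 'k::field_char_0) weyl set"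
  assumes L: "left_ideal L"
    and "finite F" "F \<subseteq> L"
    and "\<And>r. r \<in> R \<Longrightarrow> normal_ordering r"
    and "\<And>r m. r \<in> R \<Longrightarrow> m \<in> J \<Longrightarrow> \<exists>u\<in>F - {0}. \<exists>b. m = b + lead_exponent r u"
  shows "\<exists>U. finite U \<and> U \<subseteq> L \<and> (\<forall>r\<in>R. lead_divisible r L U)"
  using assms(2-)
proof (induction J arbitrary: F R rule: wf_induct_rule[OF wf_up_closed])
  case (1 J F R)
  note IH = 1(1) and F = 1(2,3) and R = 1(4) and J = 1(5)
  show ?case
  proof (cases "\<forall>r\<in>R. \<forall>x\<in>L - {0}. lead_exponent r x \<in> J")
    case True
    then have "\<forall>r\<in>R. lead_divisible r L F"
      using J unfolding lead_divisible_def by blast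
    with F show ?thesis by blast
  next
    case False
    then obtain r x where r: "r \<in> R" and x: "x \<in> L" "x \<noteq> 0" "lead_exponent r x \<notin> J" by blast
    interpret normal_order r using R[OF r] by unfold_locales
    let ?m = "lead x"
    obtain v where v: "weyl_monom ?m - v \<in> L" "\<forall>a\<in>weyl_supp v. \<forall>x\<in>L - {0}. lead x \<noteq> a"
      using normal_form[OF L, of "weyl_monom ?m"] by blast
    define f where "f = weyl_monom ?m - v"
    have "?m \<notin> weyl_supp v" using v(2) x by blast
    then have "?m \<in> weyl_supp f"
      by (simp add: f_def weyl_supp_def in_keys_iff lookup_minus)
    then have f: "f \<in> L" "f \<noteq> 0" using v(1) by (auto simp: f_def)
    have f_supp: "a \<notin> J" if "a \<in> weyl_supp f" for a
    proof (cases "a = ?m")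
      case False
      have "weyl_supp f \<subseteq> {?m} \<union> weyl_supp v"
        using weyl_supp_diff[of "weyl_monom ?m" v] by (simp add: f_def weyl_supp_def)
      then have a: "a \<in> weyl_supp v" using that False by blast
      show ?thesis
      proof
        assume "a \<in> J"
        then obtain u b where u: "u \<in> F" "u \<noteq> 0" "a = b + lead u" using J[OF r] by blast
        have "lead (weyl_monom b * u) = a" unfolding u(3) by (rule lead_monom_mult(2)[OF u(2)])
        moreover have "weyl_monom b * u \<in> L - {0}"
          using L F(2) u(1) lead_monom_mult(1)[OF u(2)] unfolding left_ideal_def by blast
        ultimately show False using v(2) a by blast
      qed
    qed (use x(3) in simp)
    define J' where "J' t = {m + c | m c. m \<in> insert t J}" for t
    have "\<exists>U. finite U \<and> U \<subseteq> L \<and> (\<forall>r\<in>{r\<in>R. lead_exponent r f = t}. lead_divisible r L U)"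
      if t: "t \<in> weyl_supp f" for t
    proof (rule IH)
      have sub: "insert t J \<subseteq> J' t"
        unfolding J'_def by (intro subsetI CollectI exI[of _ 0] exI conjI) (rule add_0_right[symmetric])
      have "up_closed (J' t)"
        unfolding up_closed_def
      proof (intro ballI allI)
        fix m c assume "m \<in> J' t"
        then obtain j d where "m = j + d" "j \<in> insert t J" unfolding J'_def by blast
        then have "m + c = j + (d + c)" "j \<in> insert t J" by (simp_all only: add.assoc)
        then show "m + c \<in> J' t" unfolding J'_def by blast
      qed
      then show "(J' t, J) \<in> {(J', J). up_closed J' \<and> J \<subset> J'}"
        using sub f_supp[OF t] by blast
      show "finite (insert f F)" "insert f F \<subseteq> L" using F f by auto
      fix r assume r: "r \<in> {r\<in>R. lead_exponent r f = t}"
      then show "normal_ordering r" using R by blast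
      fix m assume "m \<in> J' t"
      then obtain j c where "m = j + c" and j: "j \<in> insert t J"
        unfolding J'_def by blast
      then have m: "m = c + j" by (simp only: add.commute)
      from j consider "j = t" | "j \<in> J" by blast
      then show "\<exists>u\<in>insert f F - {0}. \<exists>b. m = b + lead_exponent r u"
      proof cases
        case 1
        then show ?thesis using r f(2) m by blast
      next
        case 2
        then obtain u b where "u \<in> F - {0}" "j = b + lead_exponent r u" using J r by blast
        then have "m = (c + b) + lead_exponent r u" using m by (simp only: add.assoc)
        with \<open>u \<in> F - {0}\<close> show ?thesis by blast
      qed
    qed
    then have "\<forall>t\<in>weyl_supp f. \<exists>U. finite U \<and> U \<subseteq> L \<and>
        (\<forall>r\<in>{r\<in>R. lead_exponent r f = t}. lead_divisible r L U)" by (rule ballI)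
    from bchoice[OF this] obtain U where U: "\<forall>t\<in>weyl_supp f. finite (U t) \<and> U t \<subseteq> L \<and>
        (\<forall>r\<in>{r\<in>R. lead_exponent r f = t}. lead_divisible r L (U t))" by (rule exE)
    let ?U = "\<Union>t\<in>weyl_supp f. U t"
    have "lead_divisible r L ?U" if "r \<in> R" for r
    proof -
      interpret r': normal_order r using R[OF that] by unfold_locales
      have t: "r'.lead f \<in> weyl_supp f" by (rule r'.lead(1)[OF f(2)])
      then have "lead_divisible r L (U (r'.lead f))" using U that by simp
      then show ?thesis using t unfolding lead_divisible_def by blast
    qed
    moreover have "finite ?U" "?U \<subseteq> L" using U by auto
    ultimately show ?thesis by blast
  qed
qed

text \<open>
  The refinement starts from the empty set and all normal orderings.
\<close>

lemma ex_universal_groebner_basis: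
  assumes "left_ideal L"
  shows "\<exists>U. universal_groebner_basis L U"
proof -
  obtain U where U: "finite U" "U \<subseteq> L" "\<forall>r\<in>{r. normal_ordering r}. lead_divisible r L U"
    using universal_groebner_refinement[OF assms, of "{}" "{r. normal_ordering r}" "{}"] by blast
  then have "groebner_basis r L U" if "normal_ordering r" for r
  proof -
    interpret normal_order r using that by unfold_locales
    show ?thesis using U that by (intro groebner_basisI assms) simp_all
  qed
  with U show ?thesis unfolding universal_groebner_basis_def by blast
qed

section \<open>Weight filtrations and symbols\<close>

lemma weyl_filt_iff: "w \<in> weyl_filt \<omega> i \<longleftrightarrow> (\<forall>m\<in>weyl_supp w. int (dot \<omega> m) \<le> i)"
proof -
  have "ereal (real (dot \<omega> m)) \<le> ereal (real_of_int i) \<longleftrightarrow> int (dot \<omega> m) \<le> i" for m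
    unfolding ereal_less_eq(3) by linarith
  then show ?thesis by (simp add: weyl_filt_def weyl_degree_def SUP_le_iff)
qed

lemma weyl_filt_zero [simp]: "0 \<in> weyl_filt \<omega> i"
  by (simp add: weyl_filt_iff)

lemma weyl_filt_add: "v \<in> weyl_filt \<omega> i \<Longrightarrow> w \<in> weyl_filt \<omega> i \<Longrightarrow> v + w \<in> weyl_filt \<omega> i"
  unfolding weyl_filt_iff using weyl_supp_add by blast

lemma weyl_filt_diff: "v \<in> weyl_filt \<omega> i \<Longrightarrow> w \<in> weyl_filt \<omega> i \<Longrightarrow> v - w \<in> weyl_filt \<omega> i"
  unfolding weyl_filt_iff using weyl_supp_diff by blast

lemma weyl_filt_uminus: "v \<in> weyl_filt \<omega> i \<Longrightarrow> - v \<in> weyl_filt \<omega> i"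
  using weyl_filt_diff[of 0 \<omega> i v] by simp

lemma weyl_filt_mono: "w \<in> weyl_filt \<omega> i \<Longrightarrow> i \<le> j \<Longrightarrow> w \<in> weyl_filt \<omega> j"
  unfolding weyl_filt_iff using order_trans by blast

lemma weyl_filt_of_coeffs:
  "weyl_of_coeffs p \<in> weyl_filt \<omega> i \<longleftrightarrow> (\<forall>m\<in>Poly_Mapping.keys p. int (dot \<omega> m) \<le> i)"
  by (simp add: weyl_filt_iff weyl_supp_def)

lemma weyl_filt_exhaust: "\<exists>i. w \<in> weyl_filt \<omega> i"
proof (intro exI)
  show "w \<in> weyl_filt \<omega> (\<Sum>m\<in>weyl_supp w. int (dot \<omega> m))"
    unfolding weyl_filt_iff by (intro ballI member_le_sum) simp_all
qed

lemma dot_add: "dot \<omega> (a + b) = dot \<omega> a + dot \<omega> b"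
  by (simp add: dot_def lookup_add distrib_left sum.distrib)

lemma dot_zero [simp]: "dot \<omega> 0 = 0"
  by (simp add: dot_def)

text \<open>
  This is where the condition \<open>\<omega>\<^sub>i + \<omega>\<^bsub>n+i\<^esub> > 0\<close> enters.
\<close>

lemma dot_diag_less:
  assumes "\<omega> \<in> Weights" "diag_less a b"
  shows "dot \<omega> a < dot \<omega> b"
proof -
  obtain s where s: "s \<noteq> 0" "b = a + (s, s)" using assms(2) unfolding diag_less_def by blast
  obtain i where "Poly_Mapping.lookup s i \<noteq> 0" using s(1) by (auto simp: poly_mapping_eq_iff fun_eq_iff)
  then have "0 < (\<omega> (Inl i) + \<omega> (Inr i)) * Poly_Mapping.lookup s i"
    using assms(1) by (simp add: Weights_def)
  also have "\<dots> \<le> (\<Sum>i\<in>UNIV. (\<omega> (Inl i) + \<omega> (Inr i)) * Poly_Mapping.lookup s i)"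
    by (rule member_le_sum) simp_all
  also have "\<dots> = dot \<omega> (s, s)" by (simp add: dot_def distrib_right sum.distrib)
  finally show ?thesis by (simp add: s(2) dot_add)
qed

text \<open>
  Symbols multiply as in \<open>K[X,Y]\<close>: the associated graded ring is the commutative polynomial ring.
\<close>

lemma weyl_filt_mult_symbol:
  assumes "\<omega> \<in> Weights" "v \<in> weyl_filt \<omega> i" "w \<in> weyl_filt \<omega> j"
  shows "v * w - weyl_of_coeffs (weyl_coeffs v * weyl_coeffs w) \<in> weyl_filt \<omega> (i + j - 1)"
  unfolding weyl_filt_iff
proof
  fix k assume "k \<in> weyl_supp (v * w - weyl_of_coeffs (weyl_coeffs v * weyl_coeffs w))"
  then have "k \<in> Poly_Mapping.keys (weyl_coeffs (v * w) - weyl_coeffs v * weyl_coeffs w)"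
    by (simp add: weyl_supp_def)
  from weyl_coeffs_mult[OF this] obtain a b where
    ab: "a \<in> weyl_supp v" "b \<in> weyl_supp w" "diag_less k (a + b)" by blast
  have "int (dot \<omega> a) \<le> i" "int (dot \<omega> b) \<le> j" using assms(2,3) ab(1,2) unfolding weyl_filt_iff by blast+
  then show "int (dot \<omega> k) \<le> i + j - 1"
    using dot_diag_less[OF assms(1) ab(3)] by (simp add: dot_add)
qed

lemma keys_mult_dot_le:
  assumes "\<And>m. m \<in> Poly_Mapping.keys p \<Longrightarrow> int (dot \<omega> m) \<le> i"
    and "\<And>m. m \<in> Poly_Mapping.keys q \<Longrightarrow> int (dot \<omega> m) \<le> j"
    and "k \<in> Poly_Mapping.keys (p * q)"
  shows "int (dot \<omega> k) \<le> i + j"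
proof -
  obtain a b where "k = a + b" "a \<in> Poly_Mapping.keys p" "b \<in> Poly_Mapping.keys q"
    using keys_mult[of p q] assms(3) by blast
  then show ?thesis using assms(1)[of a] assms(2)[of b] by (simp add: dot_add)
qed

lemma weyl_filt_mult:
  assumes "\<omega> \<in> Weights" "v \<in> weyl_filt \<omega> i" "w \<in> weyl_filt \<omega> j"
  shows "v * w \<in> weyl_filt \<omega> (i + j)"
proof -
  have "weyl_of_coeffs (weyl_coeffs v * weyl_coeffs w) \<in> weyl_filt \<omega> (i + j)"
    unfolding weyl_filt_of_coeffs using assms(2,3) unfolding weyl_filt_iff weyl_supp_def
    by (intro ballI keys_mult_dot_le) simp_all
  from weyl_filt_add[OF weyl_filt_mono[OF weyl_filt_mult_symbol[OF assms]] this]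
  show ?thesis by simp
qed

lemma weyl_filt_commutator:
  assumes "\<omega> \<in> Weights" "v \<in> weyl_filt \<omega> i" "w \<in> weyl_filt \<omega> j"
  shows "v * w - w * v \<in> weyl_filt \<omega> (i + j - 1)"
  using weyl_filt_diff[OF weyl_filt_mult_symbol[OF assms] weyl_filt_mult_symbol[OF assms(1,3,2), unfolded add.commute[of j i]]]
  by (simp add: mult.commute[of "weyl_coeffs w"])

text \<open>
  Homogeneous components for the grading of \<open>K[X,Y]\<close> by \<open>\<omega>\<close>. Degrees are integers, as in the
  filtrations; components of negative degree vanish.
\<close>

lift_definition hom_part :: "('n::finite + 'n \<Rightarrow> nat) \<Rightarrow> int \<Rightarrow> ('n, 'k::zero) poly_XY \<Rightarrow> ('n, 'k) poly_XY"
  is "\<lambda>\<omega> d p m. if int (dot \<omega> m) = d then p m else 0"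
  by (rule finite_subset[rotated]) auto

lemma keys_hom_part: "Poly_Mapping.keys (hom_part \<omega> d p) = {m \<in> Poly_Mapping.keys p. int (dot \<omega> m) = d}"
  by (auto simp: in_keys_iff hom_part.rep_eq split: if_splits)

lemma hom_part_zero [simp]: "hom_part \<omega> d 0 = 0"
  by (intro poly_mapping_eqI) (simp add: hom_part.rep_eq)

lemma hom_part_add: "hom_part \<omega> d (p + q) = hom_part \<omega> d p + hom_part \<omega> d q"
  by (intro poly_mapping_eqI) (simp add: hom_part.rep_eq lookup_add)

lemma hom_part_diff: "hom_part \<omega> d (p - q) = hom_part \<omega> d p - hom_part \<omega> d q"
  by (intro poly_mapping_eqI) (simp add: hom_part.rep_eq lookup_minus)

lemma hom_part_single:
  "hom_part \<omega> d (Poly_Mapping.single m c) = (if int (dot \<omega> m) = d then Poly_Mapping.single m c else 0)"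
  by (intro poly_mapping_eqI) (auto simp: hom_part.rep_eq lookup_single when_def)

lemma hom_part_single_mult:
  "hom_part \<omega> d (Poly_Mapping.single m c * p) = Poly_Mapping.single m c * hom_part \<omega> (d - int (dot \<omega> m)) p"
  by (induction p rule: single_induct_poly)
    (auto simp: hom_part_single hom_part_add mult_single dot_add distrib_left)

lemma hom_part_sum: "(\<Sum>d\<in>(\<lambda>m. int (dot \<omega> m)) ` Poly_Mapping.keys p. hom_part \<omega> d p) = p"
  by (intro poly_mapping_eqI) (auto simp: lookup_sum hom_part.rep_eq in_keys_iff)

lemma hom_part_hom_part: "hom_part \<omega> e (hom_part \<omega> d p) = (if e = d then hom_part \<omega> d p else 0)"
  by (intro poly_mapping_eqI) (simp add: hom_part.rep_eq)

lemma hom_part_filt: "weyl_of_coeffs (hom_part \<omega> d p) \<in> weyl_filt \<omega> d"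
  by (auto simp: weyl_filt_of_coeffs keys_hom_part)

lemma hom_part_eq_0: "w \<in> weyl_filt \<omega> (d - 1) \<Longrightarrow> hom_part \<omega> d (weyl_coeffs w) = 0"
  by (intro poly_mapping_eqI) (force simp: weyl_filt_iff weyl_supp_def hom_part.rep_eq in_keys_iff)

lemma hom_part_rest:
  assumes "w \<in> weyl_filt \<omega> d"
  shows "weyl_of_coeffs (hom_part \<omega> d (weyl_coeffs w)) - w \<in> weyl_filt \<omega> (d - 1)"
  unfolding weyl_filt_iff
proof
  fix m assume "m \<in> weyl_supp (weyl_of_coeffs (hom_part \<omega> d (weyl_coeffs w)) - w)"
  then have "int (dot \<omega> m) \<noteq> d" "m \<in> weyl_supp w"
    by (auto simp: weyl_supp_def in_keys_iff lookup_minus hom_part.rep_eq split: if_splits)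
  with assms show "int (dot \<omega> m) \<le> d - 1" unfolding weyl_filt_iff by fastforce
qed

lemma gr_of_poly_eq:
  "gr_of_poly \<omega> p d = weyl_filt \<omega> (d - 1) +>\<^bsub>weyl_module\<^esub> weyl_of_coeffs (hom_part \<omega> d p)"
  unfolding gr_of_poly_def weyl_of_coeffs_def keys_hom_part
  by (simp add: hom_part.rep_eq cong: sum.cong_simp)

lemma weyl_module_coset: "F +>\<^bsub>weyl_module\<^esub> x = {h + x | h. h \<in> F}"
  by (auto simp: a_r_coset_def' weyl_module_def)

lemma weyl_filt_coset_eq_iff:
  "weyl_filt \<omega> i +>\<^bsub>weyl_module\<^esub> x = weyl_filt \<omega> i +>\<^bsub>weyl_module\<^esub> y \<longleftrightarrow> x - y \<in> weyl_filt \<omega> i"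
proof
  assume "weyl_filt \<omega> i +>\<^bsub>weyl_module\<^esub> x = weyl_filt \<omega> i +>\<^bsub>weyl_module\<^esub> y"
  moreover have "x \<in> weyl_filt \<omega> i +>\<^bsub>weyl_module\<^esub> x"
    unfolding weyl_module_coset by (rule CollectI, rule exI[of _ 0]) simp
  ultimately show "x - y \<in> weyl_filt \<omega> i" unfolding weyl_module_coset by auto
next
  assume xy: "x - y \<in> weyl_filt \<omega> i"
  show "weyl_filt \<omega> i +>\<^bsub>weyl_module\<^esub> x = weyl_filt \<omega> i +>\<^bsub>weyl_module\<^esub> y"
  proof (intro equalityI subsetI)
    fix z assume "z \<in> weyl_filt \<omega> i +>\<^bsub>weyl_module\<^esub> x"
    then obtain h where "h \<in> weyl_filt \<omega> i" "z = (h + (x - y)) + y" by (auto simp: weyl_module_coset)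
    then show "z \<in> weyl_filt \<omega> i +>\<^bsub>weyl_module\<^esub> y"
      using weyl_filt_add[OF _ xy] unfolding weyl_module_coset by blast
  next
    fix z assume "z \<in> weyl_filt \<omega> i +>\<^bsub>weyl_module\<^esub> y"
    then obtain h where "h \<in> weyl_filt \<omega> i" "z = (h - (x - y)) + x" by (auto simp: weyl_module_coset)
    then show "z \<in> weyl_filt \<omega> i +>\<^bsub>weyl_module\<^esub> x"
      using weyl_filt_diff[OF _ xy] unfolding weyl_module_coset by blast
  qed
qed

text \<open>
  An element \<open>x\<close> as on the right automatically lies in degree \<open>d\<close> of the filtration, since the
  homogeneous component of \<open>p\<close> does.
\<close>

lemma gr_ideal_iff:
  "p \<in> gr_ideal \<omega> L \<longleftrightarrow> (\<forall>d. \<exists>x\<in>L. weyl_of_coeffs (hom_part \<omega> d p) - x \<in> weyl_filt \<omega> (d - 1))"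
proof -
  have "x \<in> weyl_filt \<omega> d" if "weyl_of_coeffs (hom_part \<omega> d p) - x \<in> weyl_filt \<omega> (d - 1)" for d x
    using weyl_filt_diff[OF hom_part_filt[of \<omega> d p] weyl_filt_mono[OF that, of d]] by simp
  then show ?thesis
    unfolding gr_ideal_def gr_of_poly_eq weyl_filt_coset_eq_iff by blast
qed

lemma hom_part_mem_gr_ideal:
  assumes "left_ideal L" "x \<in> L" "x \<in> weyl_filt \<omega> d"
  shows "hom_part \<omega> d (weyl_coeffs x) \<in> gr_ideal \<omega> L"
  unfolding gr_ideal_iff
proof
  fix e
  show "\<exists>y\<in>L. weyl_of_coeffs (hom_part \<omega> e (hom_part \<omega> d (weyl_coeffs x))) - y \<in> weyl_filt \<omega> (e - 1)"
  proof (cases "e = d")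
    case True
    with hom_part_rest[OF assms(3)] assms(2) show ?thesis by (auto simp: hom_part_hom_part)
  next
    case False
    with assms(1) show ?thesis
      by (intro bexI[of _ 0]) (simp_all add: hom_part_hom_part left_ideal_def)
  qed
qed

lemma hom_part_mem_gr_idealE:
  assumes "p \<in> gr_ideal \<omega> L"
  obtains x where "x \<in> L" "x \<in> weyl_filt \<omega> d" "hom_part \<omega> d p = hom_part \<omega> d (weyl_coeffs x)"
proof -
  obtain x where x: "x \<in> L" "weyl_of_coeffs (hom_part \<omega> d p) - x \<in> weyl_filt \<omega> (d - 1)"
    using assms unfolding gr_ideal_iff by blast
  have "x \<in> weyl_filt \<omega> d"
    using weyl_filt_diff[OF hom_part_filt[of \<omega> d p] weyl_filt_mono[OF x(2), of d]] by simp
  moreover have "hom_part \<omega> d p = hom_part \<omega> d (weyl_coeffs x)"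
    using hom_part_eq_0[OF x(2)] by (simp add: hom_part_diff hom_part_hom_part)
  ultimately show ?thesis using that x(1) by blast
qed

lemma gr_ideal_ideal:
  fixes L :: "('n::finite, 'k::field_char_0) weyl set"
  assumes "\<omega> \<in> Weights" "left_ideal L"
  shows "ideal (gr_ideal \<omega> L) K_XY"
proof (rule K_XY_idealI)
  show zero: "0 \<in> gr_ideal \<omega> L"
    unfolding gr_ideal_iff using assms(2) by (intro allI bexI[of _ 0]) (simp_all add: left_ideal_def)
  show add: "p + q \<in> gr_ideal \<omega> L" if p: "p \<in> gr_ideal \<omega> L" and q: "q \<in> gr_ideal \<omega> L" for p q
    unfolding gr_ideal_iff
  proof
    fix d
    obtain x y where xy: "x \<in> L" "weyl_of_coeffs (hom_part \<omega> d p) - x \<in> weyl_filt \<omega> (d - 1)"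
      "y \<in> L" "weyl_of_coeffs (hom_part \<omega> d q) - y \<in> weyl_filt \<omega> (d - 1)"
      using p q unfolding gr_ideal_iff by meson
    have "x + y \<in> L" using xy assms(2) by (simp add: left_ideal_def)
    moreover have "weyl_of_coeffs (hom_part \<omega> d (p + q)) - (x + y) \<in> weyl_filt \<omega> (d - 1)"
      using weyl_filt_add[OF xy(2,4)] by (simp add: hom_part_add weyl_of_coeffs_add algebra_simps)
    ultimately show "\<exists>x\<in>L. weyl_of_coeffs (hom_part \<omega> d (p + q)) - x \<in> weyl_filt \<omega> (d - 1)" by blast
  qed
  have single: "Poly_Mapping.single m c * q \<in> gr_ideal \<omega> L" if q: "q \<in> gr_ideal \<omega> L" for m c q
    unfolding gr_ideal_iff
  proof
    fix d
    let ?e = "d - int (dot \<omega> m)"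
    let ?w = "weyl_of_coeffs (hom_part \<omega> ?e q)"
    let ?t = "weyl_scalar c * weyl_monom m :: ('n, 'k) weyl"
    obtain x where x: "x \<in> L" "?w - x \<in> weyl_filt \<omega> (?e - 1)"
      using q unfolding gr_ideal_iff by blast
    have t: "?t \<in> weyl_filt \<omega> (int (dot \<omega> m))"
      by (simp add: weyl_filt_iff weyl_supp_def)
    have idx: "int (dot \<omega> m) + ?e - 1 = d - 1" "int (dot \<omega> m) + (?e - 1) = d - 1" by simp_all
    have "?t * (?w - x) - (?t * ?w - weyl_of_coeffs (weyl_coeffs ?t * weyl_coeffs ?w)) \<in> weyl_filt \<omega> (d - 1)"
      by (rule weyl_filt_diff[OF weyl_filt_mult[OF assms(1) t x(2), unfolded idx]
            weyl_filt_mult_symbol[OF assms(1) t hom_part_filt, of ?e q, unfolded idx]])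
    then have "weyl_of_coeffs (hom_part \<omega> d (Poly_Mapping.single m c * q)) - ?t * x \<in> weyl_filt \<omega> (d - 1)"
      by (simp add: hom_part_single_mult right_diff_distrib)
    moreover have "?t * x \<in> L" using x(1) assms(2) unfolding left_ideal_def by blast
    ultimately show "\<exists>x\<in>L. weyl_of_coeffs (hom_part \<omega> d (Poly_Mapping.single m c * q)) - x \<in> weyl_filt \<omega> (d - 1)" by blast
  qed
  show "p * q \<in> gr_ideal \<omega> L" if q: "q \<in> gr_ideal \<omega> L" for p q
    using single[OF q] add zero
    by (induction p rule: single_induct_poly) (simp_all add: distrib_right)
qed

section \<open>The graded ideal is determined by the leading faces of a universal Groebner basis\<close>

text \<open>
  Ties are broken lexicographically with respect to an enumeration \<open>e\<close> of the variables: \<open>lex\<close>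
  transports exponents additively into \<open>nat \<Rightarrow>\<^sub>0 nat\<close>, whose order is lexicographic.
\<close>

lemma ex_normal_ordering_refining_weight:
  fixes \<omega> :: "'n::finite + 'n \<Rightarrow> nat"
  shows "\<exists>r. normal_ordering r \<and> (\<forall>a b. (a, b) \<in> r \<longrightarrow> dot \<omega> a \<le> dot \<omega> b)"
proof -
  obtain e :: "'n + 'n \<Rightarrow> nat" where e: "inj e"
    using finite_imp_inj_to_nat_seg[of "UNIV :: ('n + 'n) set"] by auto
  define lex :: "'n biexponent \<Rightarrow> (nat \<Rightarrow>\<^sub>0 nat)" where
    "lex m = (\<Sum>i\<in>UNIV. Poly_Mapping.single (e (Inl i)) (Poly_Mapping.lookup (fst m) i)) +
             (\<Sum>i\<in>UNIV. Poly_Mapping.single (e (Inr i)) (Poly_Mapping.lookup (snd m) i))" for m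
  have lex_add: "lex (a + b) = lex a + lex b" for a b
    by (simp add: lex_def lookup_add single_add sum.distrib add_ac)
  have eq: "e x = e y \<longleftrightarrow> x = y" for x y using e by (rule inj_eq)
  have "Poly_Mapping.lookup (lex m) (e (Inl i)) = Poly_Mapping.lookup (fst m) i"
    "Poly_Mapping.lookup (lex m) (e (Inr i)) = Poly_Mapping.lookup (snd m) i" for m i
    by (simp_all add: lex_def lookup_add lookup_sum lookup_single when_def eq)
  then have lex_inj: "a = b" if "lex a = lex b" for a b
    using that by (metis prod_eqI poly_mapping_eqI)
  have lex_nonneg: "0 \<le> p" for p :: "nat \<Rightarrow>\<^sub>0 nat"
  proof (rule ccontr)
    assume "\<not> 0 \<le> p"
    then have "p < 0" by simp
    then show False by transfer (simp add: less_fun_def)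
  qed
  define r where "r = {(a, b). dot \<omega> a < dot \<omega> b \<or> dot \<omega> a = dot \<omega> b \<and> lex a \<le> lex b}"
  have r_iff: "(a, b) \<in> r \<longleftrightarrow> dot \<omega> a < dot \<omega> b \<or> dot \<omega> a = dot \<omega> b \<and> lex a \<le> lex b" for a b
    by (simp add: r_def)
  have "linear_order r"
    unfolding linear_order_on_def partial_order_on_def preorder_on_def
  proof (intro conjI)
    show "refl r" by (rule refl_onI) (simp_all add: r_iff)
    show "trans r" by (rule transI) (auto simp: r_iff)
    show "antisym r"
    proof (rule antisymI)
      fix a b assume "(a, b) \<in> r" "(b, a) \<in> r"
      then have "lex a = lex b" by (auto simp: r_iff)
      then show "a = b" by (rule lex_inj)
    qed
    show "total r" unfolding total_on_def r_iff using linorder_less_linear linorder_linear by metis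
  qed simp_all
  moreover have "(0, a) \<in> r" for a
  proof -
    have "lex 0 = 0" using lex_add[of 0 0] by simp
    then show ?thesis using lex_nonneg[of "lex a"] unfolding r_iff
      by (cases "dot \<omega> a = 0") simp_all
  qed
  moreover have "(a + c, b + c) \<in> r" if "(a, b) \<in> r" for a b c
    using that by (simp add: r_iff dot_add lex_add add_right_mono)
  ultimately have "normal_ordering r" unfolding normal_ordering_def by blast
  moreover have "dot \<omega> a \<le> dot \<omega> b" if "(a, b) \<in> r" for a b
    using that unfolding r_iff by linarith
  ultimately show ?thesis by blast
qed

definition lead_face :: "('n::finite + 'n \<Rightarrow> nat) \<Rightarrow> ('n, 'k::field_char_0) weyl \<Rightarrow> 'n biexponent set" where
  "lead_face \<omega> u = {m \<in> weyl_supp u. \<forall>m'\<in>weyl_supp u. dot \<omega> m' \<le> dot \<omega> m}"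

text \<open>
  Both sides are the part of \<open>u\<close> supported on the common face, that is, its symbol.
\<close>

lemma hom_part_lead_face:
  assumes "m \<in> lead_face \<omega> u" "m \<in> lead_face \<omega>' u" "lead_face \<omega> u = lead_face \<omega>' u"
  shows "hom_part \<omega> (int (dot \<omega> m)) (weyl_coeffs u) = hom_part \<omega>' (int (dot \<omega>' m)) (weyl_coeffs u)"
proof (rule poly_mapping_eqI)
  fix k
  have *: "dot \<omega> k = dot \<omega> m \<longleftrightarrow> k \<in> lead_face \<omega> u" if "k \<in> weyl_supp u" "m \<in> lead_face \<omega> u" for \<omega>
    using that unfolding lead_face_def by (auto intro: antisym)
  show "Poly_Mapping.lookup (hom_part \<omega> (int (dot \<omega> m)) (weyl_coeffs u)) k =
    Poly_Mapping.lookup (hom_part \<omega>' (int (dot \<omega>' m)) (weyl_coeffs u)) k"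
  proof (cases "k \<in> weyl_supp u")
    case True
    with * assms have "dot \<omega> k = dot \<omega> m \<longleftrightarrow> dot \<omega>' k = dot \<omega>' m" by blast
    then show ?thesis by (simp add: hom_part.rep_eq)
  qed (simp add: hom_part.rep_eq weyl_supp_def in_keys_iff)
qed

text \<open>
  In a normal ordering refining \<open>\<omega>\<close>, each step of the division of \<open>x\<close> by \<open>U\<close> subtracts a term whose
  degree is that of the leading exponent of \<open>x\<close>. So it either leaves the component of degree \<open>d\<close>
  unchanged or changes it by a multiple of the symbol of an element of \<open>U\<close>.
\<close>

lemma gr_ideal_mono_lead_face:
  fixes L :: "('n::finite, 'k::field_char_0) weyl set"
  assumes L: "left_ideal L" and U: "universal_groebner_basis L U"
    and \<omega>: "\<omega> \<in> Weights" "\<omega>' \<in> Weights"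
    and face: "\<And>u. u \<in> U \<Longrightarrow> lead_face \<omega> u = lead_face \<omega>' u"
  shows "gr_ideal \<omega> L \<subseteq> gr_ideal \<omega>' L"
proof -
  obtain r where r: "normal_ordering r" "\<And>a b. (a, b) \<in> r \<Longrightarrow> dot \<omega> a \<le> dot \<omega> b"
    using ex_normal_ordering_refining_weight[of \<omega>] by blast
  interpret normal_order r using r(1) by unfold_locales
  have UL: "U \<subseteq> L" and div: "lead_divisible r L U"
    using U r(1) groebner_basis_lead_divisible unfolding universal_groebner_basis_def by blast+
  let ?I = "gr_ideal \<omega>' L"
  have I: "ideal ?I K_XY" by (rule gr_ideal_ideal[OF \<omega>(2) L])
  have *: "\<forall>d. x \<in> weyl_filt \<omega> d \<longrightarrow> hom_part \<omega> d (weyl_coeffs x) \<in> ?I" if "x \<in> L" for x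
    using L UL div that
  proof (induction x rule: division_induct)
    case zero
    show ?case using K_XY_ideal_zero[OF I] by simp
  next
    case (step x u b c)
    let ?m = "lead u"
    let ?e = "int (dot \<omega> ?m)"
    let ?t = "weyl_scalar c * weyl_monom b :: ('n, 'k) weyl"
    show ?case
    proof (intro allI impI)
      fix d assume x: "x \<in> weyl_filt \<omega> d"
      have m: "?m \<in> lead_face \<omega> u"
        unfolding lead_face_def using lead[OF step(4)] r(2) by blast
      have u: "u \<in> weyl_filt \<omega> ?e"
        unfolding weyl_filt_iff using lead(2)[OF step(4)] r(2) by simp
      have t: "?t \<in> weyl_filt \<omega> (int (dot \<omega> b))"
        by (simp add: weyl_filt_iff weyl_supp_def)
      have "int (dot \<omega> (lead x)) \<le> d"
        using x lead(1)[OF step(2)] unfolding weyl_filt_iff by blast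
      then have le: "int (dot \<omega> b) + ?e \<le> d" by (simp add: step(5) dot_add)
      have tu: "?t * u \<in> weyl_filt \<omega> (int (dot \<omega> b) + ?e)"
        by (rule weyl_filt_mult[OF \<omega>(1) t u])
      have "hom_part \<omega> d (weyl_coeffs (x - ?t * u)) \<in> ?I"
        using step(6) weyl_filt_diff[OF x weyl_filt_mono[OF tu le]] by blast
      moreover have "hom_part \<omega> d (weyl_coeffs (?t * u)) \<in> ?I"
      proof (cases "int (dot \<omega> b) + ?e = d")
        case True
        have "hom_part \<omega> d (weyl_coeffs (?t * u - weyl_of_coeffs (weyl_coeffs ?t * weyl_coeffs u))) = 0"
          using weyl_filt_mult_symbol[OF \<omega>(1) t u] unfolding True by (rule hom_part_eq_0)
        then have "hom_part \<omega> d (weyl_coeffs (?t * u)) = Poly_Mapping.single b c * hom_part \<omega> ?e (weyl_coeffs u)"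
          by (simp add: hom_part_diff hom_part_single_mult flip: True)
        also have "hom_part \<omega> ?e (weyl_coeffs u) = hom_part \<omega>' (int (dot \<omega>' ?m)) (weyl_coeffs u)"
          using m face[OF step(3)] by (intro hom_part_lead_face) simp_all
        also have "Poly_Mapping.single b c * \<dots> \<in> ?I"
        proof (intro K_XY_ideal_mult[OF I] hom_part_mem_gr_ideal[OF L])
          show "u \<in> L" using step(3) UL by blast
          show "u \<in> weyl_filt \<omega>' (int (dot \<omega>' ?m))"
            using m[unfolded face[OF step(3)]] unfolding weyl_filt_iff lead_face_def by simp
        qed
        finally show ?thesis .
      next
        case False
        then have "hom_part \<omega> d (weyl_coeffs (?t * u)) = 0"
          using le by (intro hom_part_eq_0 weyl_filt_mono[OF tu]) simp
        then show ?thesis using K_XY_ideal_zero[OF I] by simp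
      qed
      ultimately have "hom_part \<omega> d (weyl_coeffs (x - ?t * u)) + hom_part \<omega> d (weyl_coeffs (?t * u)) \<in> ?I"
        by (rule K_XY_ideal_add[OF I])
      then show "hom_part \<omega> d (weyl_coeffs x) \<in> ?I" by (simp add: hom_part_diff)
    qed
  qed
  show ?thesis
  proof
    fix p assume p: "p \<in> gr_ideal \<omega> L"
    have "hom_part \<omega> d p \<in> ?I" for d
      using hom_part_mem_gr_idealE[OF p, of d] * by metis
    then show "p \<in> ?I"
      using K_XY_ideal_sum[OF I, of "(\<lambda>m. int (dot \<omega> m)) ` Poly_Mapping.keys p" "\<lambda>d. hom_part \<omega> d p"]
      by (simp add: hom_part_sum)
  qed
qed

lemma finite_card_factor:
  assumes "finite B" "\<Phi> ` A \<subseteq> B" "\<And>x y. x \<in> A \<Longrightarrow> y \<in> A \<Longrightarrow> \<Phi> x = \<Phi> y \<Longrightarrow> f x = f y"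
  shows "finite {f x | x. x \<in> A} \<and> card {f x | x. x \<in> A} \<le> card B"
proof -
  define g where "g b = f (SOME x. x \<in> A \<and> \<Phi> x = b)" for b
  have "f x = g (\<Phi> x)" if "x \<in> A" for x
    unfolding g_def using that someI_ex[of "\<lambda>y. y \<in> A \<and> \<Phi> y = \<Phi> x"] assms(3) by metis
  then have sub: "{f x | x. x \<in> A} \<subseteq> g ` B" using assms(2) by blast
  then have "card {f x | x. x \<in> A} \<le> card (g ` B)" using assms(1) by (intro card_mono) auto
  also have "\<dots> \<le> card B" by (rule card_image_le[OF assms(1)])
  finally show ?thesis using finite_subset[OF sub] assms(1) by simp
qed

text \<open>
  Stated for any quantity \<open>f\<close> that depends on \<open>G\<^sup>\<omega> L\<close> only, to cover the graded ideals and the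
  characteristic varieties together.
\<close>

lemma card_le_universal_groebner_bound:
  fixes L :: "('n::finite, 'k::field_char_0) weyl set"
  assumes L: "left_ideal L"
    and f: "\<And>\<omega> \<omega>'. \<omega> \<in> Weights \<Longrightarrow> \<omega>' \<in> Weights \<Longrightarrow> gr_ideal \<omega> L = gr_ideal \<omega>' L \<Longrightarrow> f \<omega> = f \<omega>'"
  shows "finite {f \<omega> | \<omega>. \<omega> \<in> Weights} \<and> card {f \<omega> | \<omega>. \<omega> \<in> Weights} \<le> universal_groebner_bound L"
proof -
  let ?b = "\<lambda>U. \<Prod>u\<in>U. \<Sum>k=0..card (weyl_supp u). card (weyl_supp u) choose k"
  have "universal_groebner_bound L \<in> ?b ` {U. universal_groebner_basis L U}"
    unfolding universal_groebner_bound_def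
    using ex_universal_groebner_basis[OF L] by (intro Inf_nat_def1) blast
  then obtain U where U: "universal_groebner_basis L U" and bound: "universal_groebner_bound L = ?b U"
    by blast
  have fin: "finite U" using U by (simp add: universal_groebner_basis_def)
  let ?B = "PiE U (\<lambda>u. Pow (weyl_supp u))"
  have "card ?B = (\<Prod>u\<in>U. card (Pow (weyl_supp u)))" using fin by (rule card_PiE)
  also have "\<dots> = ?b U"
    by (intro prod.cong refl) (simp add: card_Pow choose_row_sum atMost_atLeast0[symmetric])
  finally have card: "card ?B = universal_groebner_bound L" using bound by simp
  have "finite ?B" using fin by (intro finite_PiE) simp_all
  moreover have "(\<lambda>\<omega>. restrict (lead_face \<omega>) U) ` Weights \<subseteq> ?B"
    by (auto simp: lead_face_def)
  moreover have "f \<omega> = f \<omega>'" if w: "\<omega> \<in> Weights" "\<omega>' \<in> Weights" and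
    eq: "restrict (lead_face \<omega>) U = restrict (lead_face \<omega>') U" for \<omega> \<omega>'
  proof (rule f[OF w])
    have "lead_face \<omega> u = lead_face \<omega>' u" if "u \<in> U" for u
      using fun_cong[OF eq, of u] that by simp
    then show "gr_ideal \<omega> L = gr_ideal \<omega>' L"
      using gr_ideal_mono_lead_face[OF L U] w by (intro equalityI) simp_all
  qed
  ultimately show ?thesis unfolding card[symmetric] by (rule finite_card_factor)
qed

section \<open>Good filtrations and the characteristic variety\<close>

locale weyl_left_module = abelian_group M
  for M :: "('n::finite, 'k::field_char_0, 'm) weyl_mod" (structure) +
  assumes smult_closed [simp]: "x \<in> carrier M \<Longrightarrow> w \<odot> x \<in> carrier M"
    and smult_l_distr: "x \<in> carrier M \<Longrightarrow> (v + w) \<odot> x = v \<odot> x \<oplus> w \<odot> x"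
    and smult_r_distr: "x \<in> carrier M \<Longrightarrow> y \<in> carrier M \<Longrightarrow> w \<odot> (x \<oplus> y) = w \<odot> x \<oplus> w \<odot> y"
    and smult_assoc: "x \<in> carrier M \<Longrightarrow> (v * w) \<odot> x = v \<odot> (w \<odot> x)"
    and smult_one: "x \<in> carrier M \<Longrightarrow> 1 \<odot> x = x"

locale filtered_weyl_module = weyl_left_module M
  for M :: "('n::finite, 'k::field_char_0, 'm) weyl_mod" (structure) +
  fixes \<omega> :: "'n + 'n \<Rightarrow> nat" and F :: "int \<Rightarrow> 'm set"
  assumes filtration: "filtration \<omega> M F"
begin

lemma F_subgroup: "subgroup (F i) (add_monoid M)"
  using filtration by (simp add: filtration_def additive_subgroup_def)

lemma F_carrier: "x \<in> F i \<Longrightarrow> x \<in> carrier M"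
  using subgroup.subset[OF F_subgroup, of i] by auto

lemma F_add: "x \<in> F i \<Longrightarrow> y \<in> F i \<Longrightarrow> x \<oplus> y \<in> F i"
  using subgroup.m_closed[OF F_subgroup, of x i y] by simp

lemma F_zero: "\<zero> \<in> F i"
  using subgroup.one_closed[OF F_subgroup, of i] by simp

lemma F_add_cancel:
  assumes "x \<oplus> y \<in> F i" "x \<in> F i" "y \<in> carrier M"
  shows "y \<in> F i"
proof -
  have "\<ominus> x \<in> F i" using add.subgroup_self add.subgroupE(3)[OF F_subgroup assms(2)] by simp
  then have "\<ominus> x \<oplus> (x \<oplus> y) \<in> F i" using assms(1) by (rule F_add)
  then show ?thesis using assms(3) F_carrier[OF assms(2)] by (simp add: r_neg1)
qed

lemma F_mono:
  assumes "x \<in> F i" "i \<le> j"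
  shows "x \<in> F j"
  using assms(2)
proof (induction j rule: int_ge_induct)
  case (step j)
  have "F j \<subseteq> F (j + 1)" using filtration by (simp add: filtration_def)
  with step show ?case by blast
qed (rule assms(1))

lemma F_smult: "w \<in> weyl_filt \<omega> i \<Longrightarrow> x \<in> F j \<Longrightarrow> w \<odot> x \<in> F (i + j)"
  using filtration unfolding filtration_def by blast

lemma F_exhaust: "x \<in> carrier M \<Longrightarrow> \<exists>i. x \<in> F i"
  using filtration unfolding filtration_def by blast

lemma F_finsum: "finite A \<Longrightarrow> (\<And>a. a \<in> A \<Longrightarrow> f a \<in> F i) \<Longrightarrow> finsum M f A \<in> F i"
proof (induction rule: finite_induct)
  case (insert a A)
  then have "finsum M f (insert a A) = f a \<oplus> finsum M f A"
    by (intro finsum_insert) (auto intro: F_carrier)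
  with insert show ?case by (simp add: F_add)
qed (simp add: F_zero)

lemma F_coset_eq_iff:
  assumes "x \<in> carrier M"
  shows "F i +> x = F i \<longleftrightarrow> x \<in> F i"
proof
  show "F i +> x = F i \<Longrightarrow> x \<in> F i" by (rule add.coset_join1[OF _ assms F_subgroup]) (simp add: a_r_coset_def)
  show "x \<in> F i \<Longrightarrow> F i +> x = F i" by (simp add: a_r_coset_def add.coset_join2[OF assms F_subgroup])
qed

lemma F_smult_approx:
  assumes "v - w \<in> weyl_filt \<omega> (d - 1)" "x \<in> F j"
  shows "v \<odot> x \<in> F (j + d - 1) \<longleftrightarrow> w \<odot> x \<in> F (j + d - 1)"
proof -
  have *: "v \<odot> x \<in> F (j + d - 1)"
    if "v - w \<in> weyl_filt \<omega> (d - 1)" "w \<odot> x \<in> F (j + d - 1)" for v w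
  proof -
    have "(v - w) \<odot> x \<in> F (j + d - 1)" using F_smult[OF that(1) assms(2)] by (simp add: algebra_simps)
    then have "(v - w) \<odot> x \<oplus> w \<odot> x \<in> F (j + d - 1)" using that(2) by (rule F_add)
    then show ?thesis using smult_l_distr[OF F_carrier[OF assms(2)], of "v - w" w] by simp
  qed
  have "w - v \<in> weyl_filt \<omega> (d - 1)" using weyl_filt_uminus[OF assms(1)] by simp
  with *[of v w] *[of w v] assms(1) show ?thesis by blast
qed

text \<open>
  A polynomial annihilates the associated graded module iff each of its homogeneous components,
  viewed as an operator, lowers the expected filtration degree by one. In one direction the
  polynomial is applied to elements concentrated in a single degree \<open>j\<close>, which isolates its component
  of degree \<open>d\<close> in the total degree \<open>j + d\<close>. The representatives \<open>W\<close> and \<open>rep\<close> chosen in the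
  definition of the graded action may differ from the obvious ones by elements of lower degree.
\<close>

lemma gr_annihilator_iff:
  "p \<in> gr_annihilator \<omega> M F \<longleftrightarrow>
    (\<forall>d j. \<forall>x\<in>F j. weyl_of_coeffs (hom_part \<omega> d p) \<odot> x \<in> F (j + d - 1))"
proof -
  define w where "w d = weyl_of_coeffs (hom_part \<omega> d p)" for d
  define W where "W d = (SOME v. v \<in> gr_of_poly \<omega> p d)" for d
  define D where "D = {d. gr_of_poly \<omega> p d \<noteq> weyl_filt \<omega> (d - 1)}"
  define rep where "rep g i = (SOME x. x \<in> g i)" for g :: "int \<Rightarrow> 'm set" and i
  have coset0: "weyl_filt \<omega> i +>\<^bsub>weyl_module\<^esub> 0 = weyl_filt \<omega> i" for i
    by (simp add: weyl_module_coset)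
  have W: "W d - w d \<in> weyl_filt \<omega> (d - 1)" for d
  proof -
    have "w d \<in> gr_of_poly \<omega> p d"
      unfolding gr_of_poly_eq weyl_module_coset w_def[symmetric] by (rule CollectI, rule exI[of _ 0]) simp
    then have "W d \<in> gr_of_poly \<omega> p d" unfolding W_def by (rule someI)
    then show ?thesis unfolding gr_of_poly_eq weyl_module_coset w_def[symmetric] by auto
  qed
  have wd: "w d \<in> weyl_filt \<omega> d" for d unfolding w_def by (rule hom_part_filt)
  have Wd: "W d \<in> weyl_filt \<omega> d" for d
    using weyl_filt_add[OF weyl_filt_mono[OF W, of d d] wd[of d]] by simp
  have notD: "w d \<in> weyl_filt \<omega> (d - 1)" if "d \<notin> D" for d
    using that weyl_filt_coset_eq_iff[of \<omega> "d - 1" "w d" 0]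
    by (simp add: D_def gr_of_poly_eq w_def coset0)
  have finD: "finite D"
  proof (rule finite_subset)
    show "D \<subseteq> (\<lambda>m. int (dot \<omega> m)) ` Poly_Mapping.keys p"
    proof (rule subsetI, rule ccontr)
      fix d assume d: "d \<in> D" "d \<notin> (\<lambda>m. int (dot \<omega> m)) ` Poly_Mapping.keys p"
      then have "hom_part \<omega> d p = 0" by (subst keys_eq_empty[symmetric]) (auto simp: keys_hom_part)
      then show False using d(1) by (simp add: D_def gr_of_poly_eq coset0)
    qed
  qed simp
  define S where "S g i = (\<Oplus>d\<in>D. W d \<odot> rep g (i - d))" for g i
  have smult: "gr_smult \<omega> M F (gr_of_poly \<omega> p) g = (\<lambda>i. F (i - 1) +> S g i)" for g
    unfolding gr_smult_def S_def W_def rep_def D_def ..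
  have rep: "rep g i \<in> F i \<and> (\<exists>h\<in>F (i - 1). rep g i = h \<oplus> x)" if x: "x \<in> F i" and g: "g i = F (i - 1) +> x" for g i x
  proof -
    have "\<zero> \<oplus> x \<in> g i" unfolding g a_r_coset_def' using F_zero by blast
    then have "rep g i \<in> g i" unfolding rep_def by (rule someI)
    then obtain h where h: "h \<in> F (i - 1)" "rep g i = h \<oplus> x" unfolding g a_r_coset_def' by blast
    then have "rep g i \<in> F i" using F_add[OF F_mono[OF h(1), of i] x] by simp
    with h show ?thesis by blast
  qed
  have S_carrier: "S g i \<in> carrier M" if "\<And>i. rep g i \<in> F i" for g i
    unfolding S_def by (intro finsum_closed) (simp add: F_carrier[OF that])
  show ?thesis unfolding w_def[symmetric]
  proof
    assume p: "p \<in> gr_annihilator \<omega> M F"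
    show "\<forall>d j. \<forall>x\<in>F j. w d \<odot> x \<in> F (j + d - 1)"
    proof (intro allI ballI)
      fix d j x assume x: "x \<in> F j"
      show "w d \<odot> x \<in> F (j + d - 1)"
      proof (cases "d \<in> D")
        case False
        \<comment> \<open>the class of \<open>w d\<close> in degree \<open>d\<close> vanishes, so the defining sum has no such term\<close>
        have "w d \<odot> x \<in> F (d - 1 + j)" by (rule F_smult[OF notD[OF False] x])
        then show ?thesis by (simp add: algebra_simps)
      next
        case True
        define g where "g i = F (i - 1) +> (if i = j then x else \<zero>)" for i
        have g_other: "g i = F (i - 1)" if "i \<noteq> j" for i
          using that F_coset_eq_iff[of \<zero> "i - 1"] F_zero by (simp add: g_def)
        have g_ex: "\<exists>y\<in>F i. g i = F (i - 1) +> y" for i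
          unfolding g_def using x F_zero by (cases "i = j") auto
        have "{i. g i \<noteq> F (i - 1)} \<subseteq> {j}" using g_other by blast
        then have "g \<in> gr_carrier M F"
          unfolding gr_carrier_def using g_ex finite_subset[of _ "{j}"] by auto
        then have "gr_smult \<omega> M F (gr_of_poly \<omega> p) g = gr_zero F"
          using p unfolding gr_annihilator_def by blast
        then have eq: "F (j + d - 1) +> S g (j + d) = F (j + d - 1)"
          unfolding smult gr_zero_def by (simp add: fun_eq_iff)
        have rep_g: "rep g i \<in> F i" for i using g_ex[of i] rep by blast
        have S: "S g (j + d) \<in> F (j + d - 1)" using eq F_coset_eq_iff[OF S_carrier[OF rep_g]] by simp
        \<comment> \<open>in total degree \<open>j + d\<close> all other components of the polynomial meet a zero component of \<open>g\<close>\<close>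
        let ?T = "\<Oplus>d'\<in>D - {d}. W d' \<odot> rep g (j + d - d')"
        have T: "?T \<in> F (j + d - 1)"
        proof (rule F_finsum)
          fix d' assume d': "d' \<in> D - {d}"
          have "g (j + d - d') = F (j + d - d' - 1)" using d' by (intro g_other) simp
          then have "\<zero> \<in> g (j + d - d')" using F_zero by simp
          then have "rep g (j + d - d') \<in> g (j + d - d')" unfolding rep_def by (rule someI)
          then have "rep g (j + d - d') \<in> F (j + d - d' - 1)" using d' by (subst (asm) g_other) auto
          from F_smult[OF Wd this, of d'] show "W d' \<odot> rep g (j + d - d') \<in> F (j + d - 1)"
            by (simp add: algebra_simps)
        qed (use finD in simp)
        have "S g (j + d) = (\<Oplus>d'\<in>insert d (D - {d}). W d' \<odot> rep g (j + d - d'))"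
          unfolding S_def using True by (simp add: insert_absorb)
        also have "\<dots> = W d \<odot> rep g (j + d - d) \<oplus> ?T"
          using finD by (intro finsum_insert) (simp_all add: F_carrier[OF rep_g])
        finally have "?T \<oplus> W d \<odot> rep g j \<in> F (j + d - 1)"
          using S a_comm[OF F_carrier[OF T], of "W d \<odot> rep g j"] F_carrier[OF rep_g] by simp
        then have "W d \<odot> rep g j \<in> F (j + d - 1)"
          by (rule F_add_cancel[OF _ T]) (simp add: F_carrier[OF rep_g])
        then have wX: "w d \<odot> rep g j \<in> F (j + d - 1)"
          using F_smult_approx[OF W rep_g] by blast
        obtain h where h: "h \<in> F (j - 1)" "rep g j = h \<oplus> x"
          using rep[OF x, of g] by (auto simp: g_def)
        have "w d \<odot> h \<in> F (d + (j - 1))" by (rule F_smult[OF wd h(1)])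
        then have wh: "w d \<odot> h \<in> F (j + d - 1)" by (simp add: algebra_simps)
        have "w d \<odot> h \<oplus> w d \<odot> x \<in> F (j + d - 1)"
          using wX unfolding h(2) smult_r_distr[OF F_carrier[OF h(1)] F_carrier[OF x]] .
        then show ?thesis by (rule F_add_cancel[OF _ wh]) (simp add: F_carrier[OF x])
      qed
    qed
  next
    assume p: "\<forall>d j. \<forall>x\<in>F j. w d \<odot> x \<in> F (j + d - 1)"
    show "p \<in> gr_annihilator \<omega> M F"
      unfolding gr_annihilator_def
    proof (intro CollectI ballI)
      fix g assume g: "g \<in> gr_carrier M F"
      have rep_g: "rep g i \<in> F i" for i
        using g rep unfolding gr_carrier_def by blast
      have "S g i \<in> F (i - 1)" for i
        unfolding S_def
      proof (rule F_finsum[OF finD])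
        fix d
        have "w d \<odot> rep g (i - d) \<in> F (i - d + d - 1)" using p rep_g by blast
        then have "W d \<odot> rep g (i - d) \<in> F (i - d + d - 1)" using F_smult_approx[OF W rep_g] by blast
        then show "W d \<odot> rep g (i - d) \<in> F (i - 1)" by simp
      qed
      then show "gr_smult \<omega> M F (gr_of_poly \<omega> p) g = gr_zero F"
        unfolding smult gr_zero_def by (intro ext) (simp add: F_coset_eq_iff[OF S_carrier[OF rep_g]])
    qed
  qed
qed

end

text \<open>
  Each of the finitely many generators of the good filtration \<open>F\<close> lies in some \<open>F' k\<close>, and the shift
  need only account for these. The sum in \<open>c\<close> serves as an upper bound for their maximum.
\<close>

lemma good_filtration_shift:
  assumes "filtered_weyl_module M \<omega> F'" and good: "good_filtration \<omega> M F"
  shows "\<exists>c::nat. \<forall>i. F i \<subseteq> F' (i + int c)"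
proof -
  interpret F': filtered_weyl_module M \<omega> F' by fact
  obtain r :: nat and x p where x: "\<And>j. j < r \<Longrightarrow> x j \<in> carrier M"
    and F: "\<And>i. F i = {(\<Oplus>\<^bsub>M\<^esub> j\<in>{..<r}. w j \<odot>\<^bsub>M\<^esub> x j) | w. \<forall>j<r. w j \<in> weyl_filt \<omega> (i - p j)}"
    using good unfolding good_filtration_def by blast
  have "\<forall>j. \<exists>k. j < r \<longrightarrow> x j \<in> F' k" using F'.F_exhaust[OF x] by blast
  then obtain k where k: "\<And>j. j < r \<Longrightarrow> x j \<in> F' (k j)" by metis
  define c where "c = (\<Sum>j<r. nat \<bar>k j - p j\<bar>)"
  have c: "k j - p j \<le> int c" if "j < r" for j
  proof -
    have "nat \<bar>k j - p j\<bar> \<le> c" unfolding c_def using that by (intro member_le_sum) auto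
    then show ?thesis by linarith
  qed
  have "F i \<subseteq> F' (i + int c)" for i
  proof
    fix y assume "y \<in> F i"
    then obtain w where y: "y = (\<Oplus>\<^bsub>M\<^esub> j\<in>{..<r}. w j \<odot>\<^bsub>M\<^esub> x j)" and w: "\<And>j. j < r \<Longrightarrow> w j \<in> weyl_filt \<omega> (i - p j)"
      unfolding F by blast
    show "y \<in> F' (i + int c)" unfolding y
    proof (rule F'.F_finsum)
      fix j assume "j \<in> {..<r}"
      then have j: "j < r" by simp
      show "w j \<odot>\<^bsub>M\<^esub> x j \<in> F' (i + int c)"
        using F'.F_smult[OF w[OF j] k[OF j]] c[OF j] by (rule_tac F'.F_mono) auto
    qed simp
  qed
  then show ?thesis by blast
qed

lemma weyl_symbol_power:
  assumes "\<omega> \<in> Weights" and q: "\<And>m. m \<in> Poly_Mapping.keys q \<Longrightarrow> int (dot \<omega> m) = d"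
  shows "weyl_of_coeffs q ^ k - weyl_of_coeffs (q ^ k) \<in> weyl_filt \<omega> (int k * d - 1)"
    and "m \<in> Poly_Mapping.keys (q ^ k) \<Longrightarrow> int (dot \<omega> m) = int k * d"
proof -
  have hom: "int (dot \<omega> m) = int k * d" if "m \<in> Poly_Mapping.keys (q ^ k)" for k m
    using that
  proof (induction k arbitrary: m)
    case (Suc k)
    then obtain a b where "m = a + b" "a \<in> Poly_Mapping.keys q" "b \<in> Poly_Mapping.keys (q ^ k)"
      using keys_mult[of q "q ^ k"] by auto
    then show ?case using q Suc.IH by (simp add: dot_add algebra_simps)
  qed simp
  then show "m \<in> Poly_Mapping.keys (q ^ k) \<Longrightarrow> int (dot \<omega> m) = int k * d" .
  have one: "weyl_of_coeffs 1 = (1 :: ('a, 'b) weyl)"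
    by (simp add: weyl_coeffs_eq_iff[symmetric])
  let ?w = "weyl_of_coeffs q"
  have w: "?w \<in> weyl_filt \<omega> d" using q by (simp add: weyl_filt_of_coeffs)
  show "?w ^ k - weyl_of_coeffs (q ^ k) \<in> weyl_filt \<omega> (int k * d - 1)"
  proof (induction k)
    case (Suc k)
    have "weyl_of_coeffs (q ^ k) \<in> weyl_filt \<omega> (int k * d)"
      using hom by (simp add: weyl_filt_of_coeffs)
    from weyl_filt_mult_symbol[OF assms(1) w this] weyl_filt_mult[OF assms(1) w Suc]
    have "?w * (?w ^ k - weyl_of_coeffs (q ^ k)) + (?w * weyl_of_coeffs (q ^ k) - weyl_of_coeffs (q * q ^ k))
        \<in> weyl_filt \<omega> (int (Suc k) * d - 1)"
      by (intro weyl_filt_add) (simp_all add: algebra_simps)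
    then show ?case by (simp add: right_diff_distrib)
  qed (simp add: one)
qed

lemma K_XY_prime_power:
  assumes "primeideal P K_XY" "q ^ k \<in> P"
  shows "q \<in> P"
  using assms(2)
proof (induction k)
  case 0
  then show ?case using K_XY_ideal_mult[OF primeideal.axioms(1)[OF assms(1)], of 1 q] by simp
next
  case (Suc k)
  then show ?case using primeideal.I_prime[OF assms(1), of q "q ^ k"] by auto
qed

text \<open>
  Suppose that the operator \<open>w\<close> of a homogeneous \<open>q\<close> of degree \<open>d\<close> lowers degrees in \<open>F'\<close> by one. Then
  \<open>w ^ k\<close> lowers them by \<open>k\<close>, and hence in \<open>F\<close> by at least \<open>k - (c + c')\<close>, where \<open>c\<close> and \<open>c'\<close> are the
  shifts between the two filtrations. For large \<open>k\<close> this shows that \<open>q ^ k\<close> annihilates the graded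
  module of \<open>F\<close>, so that \<open>q\<close> lies in every prime ideal containing that annihilator.
\<close>

lemma Var_gr_annihilator_subset:
  assumes M: "weyl_left_module M" and \<omega>: "\<omega> \<in> Weights"
    and F: "good_filtration \<omega> M F" and F': "good_filtration \<omega> M F'"
  shows "Var (gr_annihilator \<omega> M F) \<subseteq> Var (gr_annihilator \<omega> M F')"
proof
  interpret F: filtered_weyl_module M \<omega> F
    using M F by (simp add: filtered_weyl_module_def filtered_weyl_module_axioms_def good_filtration_def)
  interpret F': filtered_weyl_module M \<omega> F'
    using M F' by (simp add: filtered_weyl_module_def filtered_weyl_module_axioms_def good_filtration_def)
  obtain c c' where c: "\<And>i. F i \<subseteq> F' (i + int c)" "\<And>i. F' i \<subseteq> F (i + int c')"
    using good_filtration_shift[OF F'.filtered_weyl_module_axioms F]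
      good_filtration_shift[OF F.filtered_weyl_module_axioms F'] by blast
  define k where "k = Suc (c + c')"
  fix P assume "P \<in> Var (gr_annihilator \<omega> M F)"
  then have P: "primeideal P K_XY" "gr_annihilator \<omega> M F \<subseteq> P" by (simp_all add: Var_def)
  have "p \<in> P" if p: "p \<in> gr_annihilator \<omega> M F'" for p
  proof -
    have "hom_part \<omega> d p \<in> P" for d
    proof -
      define q where "q = hom_part \<omega> d p"
      define w where "w = weyl_of_coeffs q"
      have q: "int (dot \<omega> m) = d" if "m \<in> Poly_Mapping.keys q" for m
        using that by (simp add: q_def keys_hom_part)
      have step: "w \<odot>\<^bsub>M\<^esub> x \<in> F' (j + d - 1)" if "x \<in> F' j" for x j
        using p that unfolding F'.gr_annihilator_iff w_def q_def by blast
      have pow: "w ^ l \<odot>\<^bsub>M\<^esub> x \<in> F' (j + int l * (d - 1))" if x: "x \<in> F' j" for x j l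
      proof (induction l)
        case 0
        then show ?case using x F.smult_one[OF F'.F_carrier[OF x]] by simp
      next
        case (Suc l)
        then show ?case
          using step[OF Suc] by (simp add: F.smult_assoc[OF F'.F_carrier[OF x]] algebra_simps)
      qed
      have pow': "w ^ k \<odot>\<^bsub>M\<^esub> x \<in> F (j + int k * d - 1)" if x: "x \<in> F j" for x j
      proof -
        have "x \<in> F' (j + int c)" using c(1) x by blast
        from pow[OF this, of k] have "w ^ k \<odot>\<^bsub>M\<^esub> x \<in> F (j + int c + int k * (d - 1) + int c')" using c(2) by blast
        then show ?thesis by (rule F.F_mono) (simp add: k_def algebra_simps)
      qed
      have "q ^ k \<in> gr_annihilator \<omega> M F"
        unfolding F.gr_annihilator_iff
      proof (intro allI ballI)
        fix e j x assume x: "x \<in> F j"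
        show "weyl_of_coeffs (hom_part \<omega> e (q ^ k)) \<odot>\<^bsub>M\<^esub> x \<in> F (j + e - 1)"
        proof (cases "e = int k * d")
          case True
          have "hom_part \<omega> e (q ^ k) = q ^ k"
            using weyl_symbol_power(2)[OF \<omega> q, where k = k] True
            by (intro poly_mapping_eqI) (auto simp: hom_part.rep_eq in_keys_iff)
          then show ?thesis
            using F.F_smult_approx[OF weyl_symbol_power(1)[OF \<omega> q, where k = k] x] pow'[OF x] True
            by (simp add: w_def)
        next
          case False
          then have "Poly_Mapping.keys (hom_part \<omega> e (q ^ k)) = {}"
            using weyl_symbol_power(2)[OF \<omega> q, where k = k] by (auto simp: keys_hom_part)
          then have "weyl_of_coeffs (hom_part \<omega> e (q ^ k)) \<in> weyl_filt \<omega> (e - 1)" by simp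
          from F.F_smult[OF this x] show ?thesis by (simp add: algebra_simps)
        qed
      qed
      then show ?thesis using K_XY_prime_power[OF P(1)] P(2) unfolding q_def by blast
    qed
    then show ?thesis
      using K_XY_ideal_sum[OF primeideal.axioms(1)[OF P(1)], of "(\<lambda>m. int (dot \<omega> m)) ` Poly_Mapping.keys p" "\<lambda>d. hom_part \<omega> d p"]
      by (simp add: hom_part_sum)
  qed
  then show "P \<in> Var (gr_annihilator \<omega> M F')" using P(1) by (auto simp: Var_def)
qed

locale weyl_quotient =
  fixes L :: "('n::finite, 'k::field_char_0) weyl set"
  assumes L: "left_ideal L"
begin

abbreviation Q where "Q \<equiv> quot_module weyl_module L"

definition cls :: "('n, 'k) weyl \<Rightarrow> ('n, 'k) weyl set" where "cls x = L +>\<^bsub>weyl_module\<^esub> x"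

lemma cls_alt: "cls x = {h + x | h. h \<in> L}"
  by (simp add: cls_def weyl_module_coset)

lemma L_zero: "0 \<in> L" and L_add: "x \<in> L \<Longrightarrow> y \<in> L \<Longrightarrow> x + y \<in> L" and L_mult: "x \<in> L \<Longrightarrow> w * x \<in> L"
  using L by (simp_all add: left_ideal_def)

lemma cls_eq_iff: "cls x = cls y \<longleftrightarrow> x - y \<in> L"
proof
  assume "cls x = cls y"
  moreover have "0 + x \<in> cls x" unfolding cls_alt using L_zero by blast
  ultimately show "x - y \<in> L" unfolding cls_alt by auto
next
  assume xy: "x - y \<in> L"
  show "cls x = cls y"
  proof (intro equalityI subsetI)
    fix z assume "z \<in> cls x"
    then obtain h where "h \<in> L" "z = (h + (x - y)) + y" by (auto simp: cls_alt)
    then show "z \<in> cls y" using L_add[OF _ xy] unfolding cls_alt by blast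
  next
    fix z assume "z \<in> cls y"
    then obtain h where "h \<in> L" "z = (h - (x - y)) + x" by (auto simp: cls_alt)
    then show "z \<in> cls x" using left_ideal_diff[OF L _ xy] unfolding cls_alt by blast
  qed
qed

lemma Q_carrier: "carrier Q = range cls"
  by (auto simp: quot_module_def A_RCOSETS_def' weyl_module_def cls_def)

lemma Q_zero: "\<zero>\<^bsub>Q\<^esub> = cls 0"
  by (simp add: quot_module_def cls_alt)

lemma Q_add: "cls x \<oplus>\<^bsub>Q\<^esub> cls y = cls (x + y)"
proof (intro equalityI subsetI)
  fix z assume "z \<in> cls x \<oplus>\<^bsub>Q\<^esub> cls y"
  then obtain h h' where h: "h \<in> L" "h' \<in> L" "z = (h + x) + (h' + y)"
    by (auto simp: quot_module_def set_add_def' weyl_module_def cls_alt)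
  then have "z = (h + h') + (x + y)" by (simp add: algebra_simps)
  with L_add[OF h(1,2)] show "z \<in> cls (x + y)" unfolding cls_alt by blast
next
  fix z assume "z \<in> cls (x + y)"
  then obtain h where h: "h \<in> L" "z = (h + x) + (0 + y)" by (auto simp: cls_alt algebra_simps)
  moreover have "h + x \<in> cls x" "0 + y \<in> cls y" using h(1) L_zero unfolding cls_alt by blast+
  ultimately show "z \<in> cls x \<oplus>\<^bsub>Q\<^esub> cls y"
    by (auto simp: quot_module_def set_add_def' weyl_module_def)
qed

lemma Q_smult: "w \<odot>\<^bsub>Q\<^esub> cls x = cls (w * x)"
proof -
  have "cls (w * c) = cls (w * x)" if "c \<in> cls x" for c
  proof -
    obtain h where h: "h \<in> L" "c = h + x" using \<open>c \<in> cls x\<close> unfolding cls_alt by blast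
    then have "w * c - w * x = w * h" by (simp add: algebra_simps)
    then show ?thesis unfolding cls_eq_iff using L_mult[OF h(1)] by simp
  qed
  moreover have "0 + x \<in> cls x" unfolding cls_alt using L_zero by blast
  ultimately have "(\<Union>c\<in>cls x. cls (w * c)) = cls (w * x)" by blast
  then show ?thesis by (simp add: quot_module_def cls_def weyl_module_def)
qed

lemma Q_module: "weyl_left_module Q"
proof -
  have "abelian_group Q"
  proof (rule abelian_groupI)
    fix x assume "x \<in> carrier Q"
    then obtain a where "x = cls a" unfolding Q_carrier by blast
    moreover have "cls (- a) \<oplus>\<^bsub>Q\<^esub> cls a = \<zero>\<^bsub>Q\<^esub>" by (simp add: Q_add Q_zero)
    ultimately show "\<exists>y\<in>carrier Q. y \<oplus>\<^bsub>Q\<^esub> x = \<zero>\<^bsub>Q\<^esub>" unfolding Q_carrier by blast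
  qed (auto simp: Q_carrier Q_add Q_zero add_ac)
  then show ?thesis
    unfolding weyl_left_module_def weyl_left_module_axioms_def
    by (auto simp: Q_carrier Q_add Q_smult distrib_left distrib_right mult.assoc)
qed

definition quot_filt :: "('n + 'n \<Rightarrow> nat) \<Rightarrow> int \<Rightarrow> ('n, 'k) weyl set set" where
  "quot_filt \<omega> i = cls ` weyl_filt \<omega> i"

lemma good_quot_filt:
  assumes "\<omega> \<in> Weights"
  shows "good_filtration \<omega> Q (quot_filt \<omega>)"
proof -
  interpret weyl_left_module Q by (rule Q_module)
  have neg: "\<ominus>\<^bsub>Q\<^esub> cls x = cls (- x)" for x
    by (rule minus_equality) (simp_all add: Q_add Q_zero Q_carrier)
  have "filtration \<omega> Q (quot_filt \<omega>)"
    unfolding filtration_def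
  proof (intro conjI allI ballI)
    fix i
    show "additive_subgroup (quot_filt \<omega> i) Q"
      unfolding additive_subgroup_def
    proof (rule add.subgroupI)
      show "quot_filt \<omega> i \<subseteq> carrier Q" unfolding quot_filt_def Q_carrier by blast
      show "quot_filt \<omega> i \<noteq> {}" unfolding quot_filt_def using weyl_filt_zero by blast
      show "\<ominus>\<^bsub>Q\<^esub> x \<in> quot_filt \<omega> i" if "x \<in> quot_filt \<omega> i" for x
        using that unfolding quot_filt_def by (auto simp: neg intro!: imageI weyl_filt_uminus)
      show "x \<oplus>\<^bsub>Q\<^esub> y \<in> quot_filt \<omega> i" if "x \<in> quot_filt \<omega> i" "y \<in> quot_filt \<omega> i" for x y
        using that unfolding quot_filt_def by (auto simp: Q_add intro!: imageI weyl_filt_add)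
    qed
    show "quot_filt \<omega> i \<subseteq> quot_filt \<omega> (i + 1)"
      unfolding quot_filt_def using weyl_filt_mono[of _ \<omega> i "i + 1"] by auto
  next
    have "cls x \<in> (\<Union>i. quot_filt \<omega> i)" for x
      using weyl_filt_exhaust[of x \<omega>] unfolding quot_filt_def by blast
    then show "(\<Union>i. quot_filt \<omega> i) = carrier Q" unfolding Q_carrier by (auto simp: quot_filt_def)
  next
    fix i j x and w :: "('n, 'k) weyl" assume "w \<in> weyl_filt \<omega> i" "x \<in> quot_filt \<omega> j"
    then show "w \<odot>\<^bsub>Q\<^esub> x \<in> quot_filt \<omega> (i + j)"
      unfolding quot_filt_def by (auto simp: Q_smult intro!: imageI weyl_filt_mult[OF assms])
  qed
  \<comment> \<open>the class of 1, placed in degree 0, generates the filtration\<close>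
  moreover have "quot_filt \<omega> i = {(\<Oplus>\<^bsub>Q\<^esub> j\<in>{..<1}. w j \<odot>\<^bsub>Q\<^esub> cls 1) | w. \<forall>j<1::nat. w j \<in> weyl_filt \<omega> (i - 0)}" for i
  proof -
    have "(\<Oplus>\<^bsub>Q\<^esub> j\<in>{..<1}. w j \<odot>\<^bsub>Q\<^esub> cls 1) = cls (w 0)" for w :: "nat \<Rightarrow> ('n, 'k) weyl"
    proof -
      have "{..<1} = {0::nat}" by auto
      then show ?thesis by (simp add: Q_smult Q_carrier)
    qed
    then show ?thesis unfolding quot_filt_def by auto
  qed
  moreover have "cls 1 \<in> carrier Q" unfolding Q_carrier by blast
  ultimately show ?thesis unfolding good_filtration_def
    by (intro conjI exI[of _ "1::nat"] exI[of _ "\<lambda>_. cls 1"] exI[of _ "\<lambda>_. 0"]) auto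
qed

text \<open>
  If \<open>w\<close> annihilates, its action on the class of 1 gives \<open>w \<in> L + F\<^bsub>d-1\<^esub>\<close>. Conversely, if
  \<open>w - x \<in> F\<^bsub>d-1\<^esub>\<close> with \<open>x \<in> L\<close>, then \<open>w v\<close> agrees modulo \<open>L\<close> with \<open>[w, v] + v (w - x)\<close>, and the
  commutator has lower degree because the associated graded ring is commutative.
\<close>

lemma gr_annihilator_quot_filt:
  assumes "\<omega> \<in> Weights"
  shows "gr_annihilator \<omega> Q (quot_filt \<omega>) = gr_ideal \<omega> L"
proof -
  interpret filtered_weyl_module Q \<omega> "quot_filt \<omega>"
    using Q_module good_quot_filt[OF assms]
    by (simp add: filtered_weyl_module_def filtered_weyl_module_axioms_def good_filtration_def)
  have "p \<in> gr_annihilator \<omega> Q (quot_filt \<omega>) \<longleftrightarrow> p \<in> gr_ideal \<omega> L" for p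
    unfolding gr_annihilator_iff gr_ideal_iff
  proof
    assume p: "\<forall>d j. \<forall>x\<in>quot_filt \<omega> j. weyl_of_coeffs (hom_part \<omega> d p) \<odot>\<^bsub>Q\<^esub> x \<in> quot_filt \<omega> (j + d - 1)"
    show "\<forall>d. \<exists>x\<in>L. weyl_of_coeffs (hom_part \<omega> d p) - x \<in> weyl_filt \<omega> (d - 1)"
    proof
      fix d
      let ?w = "weyl_of_coeffs (hom_part \<omega> d p) :: ('n, 'k) weyl"
      have "weyl_supp (1 :: ('n, 'k) weyl) = {0}"
        by (simp add: weyl_supp_def)
      then have "cls 1 \<in> quot_filt \<omega> 0" unfolding quot_filt_def by (simp add: weyl_filt_iff)
      then have "?w \<odot>\<^bsub>Q\<^esub> cls 1 \<in> quot_filt \<omega> (0 + d - 1)" using p by blast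
      then obtain y where "y \<in> weyl_filt \<omega> (d - 1)" "cls ?w = cls y"
        unfolding quot_filt_def by (auto simp: Q_smult)
      then show "\<exists>x\<in>L. ?w - x \<in> weyl_filt \<omega> (d - 1)"
        by (intro bexI[of _ "?w - y"]) (simp_all add: cls_eq_iff)
    qed
  next
    assume p: "\<forall>d. \<exists>x\<in>L. weyl_of_coeffs (hom_part \<omega> d p) - x \<in> weyl_filt \<omega> (d - 1)"
    show "\<forall>d j. \<forall>x\<in>quot_filt \<omega> j. weyl_of_coeffs (hom_part \<omega> d p) \<odot>\<^bsub>Q\<^esub> x \<in> quot_filt \<omega> (j + d - 1)"
    proof (intro allI ballI)
      fix d j z assume "z \<in> quot_filt \<omega> j"
      then obtain v where v: "v \<in> weyl_filt \<omega> j" "z = cls v" unfolding quot_filt_def by blast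
      let ?w = "weyl_of_coeffs (hom_part \<omega> d p) :: ('n, 'k) weyl"
      obtain x where x: "x \<in> L" "?w - x \<in> weyl_filt \<omega> (d - 1)" using p by blast
      let ?y = "(?w * v - v * ?w) + v * (?w - x)"
      have idx: "d + j - 1 = j + d - 1" "j + (d - 1) = j + d - 1" by simp_all
      have "?y \<in> weyl_filt \<omega> (j + d - 1)"
        by (rule weyl_filt_add[OF weyl_filt_commutator[OF assms hom_part_filt[of \<omega> d p] v(1), unfolded idx]
              weyl_filt_mult[OF assms v(1) x(2), unfolded idx]])
      moreover have "cls (?w * v) = cls ?y"
      proof -
        have "?w * v - ?y = v * x" by (simp add: algebra_simps)
        then show ?thesis unfolding cls_eq_iff using L_mult[OF x(1)] by simp
      qed
      ultimately show "?w \<odot>\<^bsub>Q\<^esub> z \<in> quot_filt \<omega> (j + d - 1)"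
        unfolding v(2) Q_smult quot_filt_def by (metis imageI)
    qed
  qed
  then show ?thesis by blast
qed

lemma char_variety_quot:
  assumes "\<omega> \<in> Weights"
  shows "char_variety \<omega> Q = Var (gr_ideal \<omega> L)"
  unfolding char_variety_def
proof (rule the_equality)
  show "\<forall>F. good_filtration \<omega> Q F \<longrightarrow> Var (gr_ideal \<omega> L) = Var (gr_annihilator \<omega> Q F)"
    unfolding gr_annihilator_quot_filt[OF assms, symmetric]
    using Var_gr_annihilator_subset[OF Q_module assms] good_quot_filt[OF assms] by (intro allI impI equalityI) blast+
next
  fix V assume "\<forall>F. good_filtration \<omega> Q F \<longrightarrow> V = Var (gr_annihilator \<omega> Q F)"
  then show "V = Var (gr_ideal \<omega> L)"
    using good_quot_filt[OF assms] gr_annihilator_quot_filt[OF assms] by metis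
qed

end

theorem mainTheorem3:
  fixes L :: "('n::finite, 'k::field_char_0) weyl set"
  assumes "left_ideal L"
  shows "finite {gr_ideal \<omega> L | \<omega>. \<omega> \<in> Weights} \<and>
    card {gr_ideal \<omega> L | \<omega>. \<omega> \<in> Weights} \<le> universal_groebner_bound L \<and>
    finite {char_variety \<omega> (quot_module weyl_module L) | \<omega>. \<omega> \<in> Weights} \<and>
    card {char_variety \<omega> (quot_module weyl_module L) | \<omega>. \<omega> \<in> Weights} \<le> universal_groebner_bound L"
proof -
  interpret weyl_quotient L using assms by unfold_locales
  have "char_variety \<omega> Q = char_variety \<omega>' Q"
    if "\<omega> \<in> Weights" "\<omega>' \<in> Weights" "gr_ideal \<omega> L = gr_ideal \<omega>' L" for \<omega> \<omega>'
    using that by (simp add: char_variety_quot)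
  then show ?thesis
    using card_le_universal_groebner_bound[OF assms, of "\<lambda>\<omega>. gr_ideal \<omega> L"]
      card_le_universal_groebner_bound[OF assms, of "\<lambda>\<omega>. char_variety \<omega> Q"] by blast
qed


end
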